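(* Let $n\ge2$, $\mathcal{G}=\widetilde{\mathrm{Sp}(2n,\mathbb{R})}$, and let $\mathcal{E}=\mathcal{G}\times_{Z(\mathcal{G})}\mathcal{H}\mathcal{R}/\mathcal{H}$ be its central extension. There is an exact sequence of groups $$0\to\mathbb{R}\to\mathcal{G}\times_{Z(\mathcal{G})}\mathcal{H}\mathcal{R}/\mathcal{H}\xrightarrow{\ \eta\ }\mathcal{G}/Z(\mathcal{G})\to0,$$ where $\mathcal{G}/Z(\mathcal{G})\cong\mathrm{PSp}(2n,\mathbb{R})$. Here $\mathbb{R}\cong\mathcal{H}\mathcal{R}/\mathcal{H}$ is embedded by $r\mathcal{H}\mapsto\theta(\mathrm{id},r\mathcal{H})$, and $\eta$ is induced by $(g,r\mathcal{H})\mapsto gZ(\mathcal{G})$.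
   Context: $\mathrm{Sp}(2n,\mathbb{R})=\{M\in M_{2n}(\mathbb{R}): M^T\Omega M=\Omega\}$, $\Omega=\begin{pmatrix} 0 & I_n \\ -I_n & 0 \end{pmatrix}$; $\mathrm{PSp}(2n,\mathbb{R})=\mathrm{Sp}(2n,\mathbb{R})/\{\pm\mathrm{id}\}$. $\mathrm{U}(n)$ is embedded in $\mathrm{Sp}(2n,\mathbb{R})$ by $A+iB\mapsto\begin{pmatrix} A & -B \\ B & A \end{pmatrix}$ ($A,B$ real). Let $\pi:\widetilde{\mathrm{Sp}(2n,\mathbb{R})}\to\mathrm{Sp}(2n,\mathbb{R})$ be the universal covering and $\widetilde{\mathrm{U}(n)}=\pi^{-1}(\mathrm{U}(n))$. Put $\mathcal{G}=\widetilde{\mathrm{Sp}(2n,\mathbb{R})}$; $\mathcal{H}=\mathrm{SU}(n)\subset\mathcal{G}$, the identity component of $\pi^{-1}(\mathrm{SU}(n))$; $\mathcal{R}\cong\mathbb{R}$, the identity component of $\pi^{-1}(\{e^{ia}\mathrm{id}:a\in\mathbb{R}\})$. Then $\mathcal{H}\mathcal{R}=\widetilde{\mathrm{U}(n)}$ is a direct product and contains the center $Z(\mathcal{G})=\pi^{-1}(\{\pm\mathrm{id}\})$. Let $i:Z(\mathcal{G})\to\mathcal{G}$ be the inclusion and $\iota:Z(\mathcal{G})\to\mathcal{H}\mathcal{R}/\mathcal{H}\cong\mathbb{R}$ the restriction of the quotient map $\mathcal{H}\mathcal{R}\to\mathcal{H}\mathcal{R}/\mathcal{H}$. Elements of $\mathcal{H}\mathcal{R}/\mathcal{H}$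 are written $r\mathcal{H}$, $r\in\mathcal{R}$. Define $$\mathcal{E}=\mathcal{G}\times_{Z(\mathcal{G})}\mathcal{H}\mathcal{R}/\mathcal{H}:=\frac{\mathcal{G}\times\mathcal{H}\mathcal{R}/\mathcal{H}}{\{(i(z),\iota(z)^{-1}):z\in Z(\mathcal{G})\}},$$ with quotient map $\theta:\mathcal{G}\times\mathcal{H}\mathcal{R}/\mathcal{H}\to\mathcal{E}$. *)

theory Defs
  imports "HOL-Analysis.Analysis" "HOL-Algebra.Coset"
begin

section \<open>The symplectic group and the unitary subgroups\<close>

text \<open>A \<open>2n \<times> 2n\<close> matrix is indexed by \<open>'n + 'n\<close> with \<open>CARD('n) = n\<close>: \<open>Inl\<close> indices form the first
  block of rows or columns, \<open>Inr\<close> indices the second.\<close>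

definition block ::
  "'a^'n^'n \<Rightarrow> 'a^'n^'n \<Rightarrow> 'a^'n^'n \<Rightarrow> 'a^'n^'n \<Rightarrow> 'a^('n::finite + 'n)^('n + 'n)" where
  "block A B C D = (\<chi> i j. case i of
      Inl k \<Rightarrow> (case j of Inl l \<Rightarrow> A $ k $ l | Inr l \<Rightarrow> B $ k $ l)
    | Inr k \<Rightarrow> (case j of Inl l \<Rightarrow> C $ k $ l | Inr l \<Rightarrow> D $ k $ l))"

definition Omega :: "real^('n::finite + 'n)^('n + 'n)" where
  "Omega = block 0 (mat 1) (- mat 1) 0"

definition Sp :: "(real^('n::finite + 'n)^('n + 'n)) monoid" where
  "Sp = \<lparr>carrier = {M. transpose M ** Omega ** M = Omega}, monoid.mult = (**), one = mat 1\<rparr>"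

definition PSp :: "(real^('n::finite + 'n)^('n + 'n)) set monoid" where
  "PSp = Sp Mod {mat 1, - mat 1}"

definition adjoint_matrix :: "complex^'n^'n \<Rightarrow> complex^'n^'n" where
  "adjoint_matrix U = (\<chi> i j. cnj (U $ j $ i))"

definition unitary_matrices :: "(complex^'n^'n) set" where
  "unitary_matrices = {U. adjoint_matrix U ** U = mat 1}"

definition special_unitary_matrices :: "(complex^'n^'n) set" where
  "special_unitary_matrices = {U \<in> unitary_matrices. det U = 1}"

definition scalar_unitary_matrices :: "(complex^'n^'n) set" where
  "scalar_unitary_matrices = {mat (exp (\<i> * complex_of_real a)) | a. True}"

text \<open>The embedding \<open>A + iB \<mapsto> (A, -B; B, A)\<close> with \<open>A\<close>, \<open>B\<close> real.\<close>

definition unitary_embedding :: "complex^'n^'n \<Rightarrow> real^('n::finite + 'n)^('n + 'n)" where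
  "unitary_embedding U =
    (let A = (\<chi> i j. Re (U $ i $ j)); B = (\<chi> i j. Im (U $ i $ j)) in block A (- B) B A)"


section \<open>Universal covering groups\<close>

text \<open>The topology of a group is the subspace topology of its carrier in the ambient type.\<close>

definition topological_group :: "('g::topological_space, 'm) monoid_scheme \<Rightarrow> bool" where
  "topological_group G \<longleftrightarrow> Group.group G \<and>
     continuous_on (carrier G \<times> carrier G) (\<lambda>(x, y). x \<otimes>\<^bsub>G\<^esub> y) \<and>
     continuous_on (carrier G) (\<lambda>x. inv\<^bsub>G\<^esub> x)"

text \<open>Path-connectedness of the covering is part of \<^const>\<open>simply_connected\<close>.\<close>

definition universal_covering_group ::
  "('g::topological_space, 'm) monoid_scheme \<Rightarrow> ('g \<Rightarrow> 'k)
     \<Rightarrow> ('k::topological_space, 'l) monoid_scheme \<Rightarrow> bool" where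
  "universal_covering_group G p K \<longleftrightarrow>
     topological_group G \<and> p \<in> hom G K \<and>
     covering_space (carrier G) p (carrier K) \<and> simply_connected (carrier G)"


section \<open>General group theory\<close>

definition center :: "('g, 'm) monoid_scheme \<Rightarrow> 'g set" where
  "center G = {z \<in> carrier G. \<forall>g \<in> carrier G. z \<otimes>\<^bsub>G\<^esub> g = g \<otimes>\<^bsub>G\<^esub> z}"

definition real_group :: "real monoid" where
  "real_group = \<lparr>carrier = UNIV, monoid.mult = (+), one = 0\<rparr>"

text \<open>Exactness of \<open>0 \<rightarrow> A \<rightarrow> B \<rightarrow> C \<rightarrow> 0\<close>. The library notion in \<open>HOL-Algebra.Exact_Sequence\<close> requires
  all the groups to have elements of one and the same type.\<close>

definition short_exact ::
  "('a, 'k) monoid_scheme \<Rightarrow> ('b, 'l) monoid_scheme \<Rightarrow> ('c, 'm) monoid_scheme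
     \<Rightarrow> ('a \<Rightarrow> 'b) \<Rightarrow> ('b \<Rightarrow> 'c) \<Rightarrow> bool" where
  "short_exact A B C f g \<longleftrightarrow>
     Group.group A \<and> Group.group B \<and> Group.group C \<and>
     f \<in> mon A B \<and> kernel B C g = f ` carrier A \<and> g \<in> epi B C"


section \<open>The extension\<close>

text \<open>Here \<open>G\<close> is the universal covering group of \<open>Sp\<close> with covering map \<open>p\<close>.\<close>

definition subgroup_H ::
  "('g::topological_space, 'm) monoid_scheme \<Rightarrow> ('g \<Rightarrow> real^('n::finite + 'n)^('n + 'n)) \<Rightarrow> 'g set"
  where
  "subgroup_H G p = connected_component_set
     {g \<in> carrier G. p g \<in> unitary_embedding ` special_unitary_matrices} \<one>\<^bsub>G\<^esub>"

definition subgroup_R ::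
  "('g::topological_space, 'm) monoid_scheme \<Rightarrow> ('g \<Rightarrow> real^('n::finite + 'n)^('n + 'n)) \<Rightarrow> 'g set"
  where
  "subgroup_R G p = connected_component_set
     {g \<in> carrier G. p g \<in> unitary_embedding ` scalar_unitary_matrices} \<one>\<^bsub>G\<^esub>"

definition group_HR ::
  "('g::topological_space, 'm) monoid_scheme \<Rightarrow> ('g \<Rightarrow> real^('n::finite + 'n)^('n + 'n))
     \<Rightarrow> ('g, 'm) monoid_scheme" where
  "group_HR G p = G\<lparr>carrier := subgroup_H G p <#>\<^bsub>G\<^esub> subgroup_R G p\<rparr>"

definition HR_mod_H ::
  "('g::topological_space, 'm) monoid_scheme \<Rightarrow> ('g \<Rightarrow> real^('n::finite + 'n)^('n + 'n))
     \<Rightarrow> 'g set monoid" where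
  "HR_mod_H G p = group_HR G p Mod subgroup_H G p"

definition quot_H ::
  "('g::topological_space, 'm) monoid_scheme \<Rightarrow> ('g \<Rightarrow> real^('n::finite + 'n)^('n + 'n))
     \<Rightarrow> 'g \<Rightarrow> 'g set" where
  "quot_H G p x = subgroup_H G p #>\<^bsub>group_HR G p\<^esub> x"

text \<open>The subgroup \<open>{(i(z), \<iota>(z)\<inverse>) | z \<in> Z(G)}\<close>; \<open>\<iota>\<close> is the restriction of \<^const>\<open>quot_H\<close>.\<close>

definition antidiagonal_center ::
  "('g::topological_space, 'm) monoid_scheme \<Rightarrow> ('g \<Rightarrow> real^('n::finite + 'n)^('n + 'n))
     \<Rightarrow> ('g \<times> 'g set) set" where
  "antidiagonal_center G p = {(z, inv\<^bsub>HR_mod_H G p\<^esub> (quot_H G p z)) | z. z \<in> center G}"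

definition extension_E ::
  "('g::topological_space, 'm) monoid_scheme \<Rightarrow> ('g \<Rightarrow> real^('n::finite + 'n)^('n + 'n))
     \<Rightarrow> ('g \<times> 'g set) set monoid" where
  "extension_E G p = (G \<times>\<times> HR_mod_H G p) Mod antidiagonal_center G p"

definition theta ::
  "('g::topological_space, 'm) monoid_scheme \<Rightarrow> ('g \<Rightarrow> real^('n::finite + 'n)^('n + 'n))
     \<Rightarrow> 'g \<times> 'g set \<Rightarrow> ('g \<times> 'g set) set" where
  "theta G p x = antidiagonal_center G p #>\<^bsub>G \<times>\<times> HR_mod_H G p\<^esub> x"

end

theory Submission
  imports Defs
begin

text \<open>Write a symplectic matrix as \<open>M = X + Y\<close> with \<open>X\<close> complex linear and \<open>Y\<close> complex antilinear.
  Then \<open>X\<^sup>TX - Y\<^sup>TY = 1\<close>, so \<open>X\<close> is invertible and \<open>det X\<close> is a nonvanishing continuous extension of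
  the complex determinant from \<open>U(n)\<close> to \<open>Sp(2n, R)\<close>. Since \<open>G\<close> is simply connected, \<open>det X\<close> has no
  monodromy along loops in \<open>G\<close>; hence the lift \<open>\<sigma>\<close> of \<open>t \<mapsto> e\<^sup>i\<^sup>t\<close> is injective, and lifting the argument of
  the determinant along paths gives a well-defined homomorphism \<open>\<alpha>\<close> from the preimage of \<open>U(n)\<close> to the
  reals with \<open>\<alpha> \<circ> \<sigma> = id\<close>. For this, the preimage of \<open>U(n)\<close> must be path connected: \<open>W = Y X\<^sup>-\<^sup>1\<close> is a symmetric
  strict contraction, and multiplying \<open>M\<close> by \<open>(1 - sW) (1 - s\<^sup>2W\<^sup>2)\<^bsup>-1/2\<^esup>\<close> deforms it within \<open>Sp(2n, R)\<close> into \<open>U(n)\<close>.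
  The kernel of \<open>\<alpha>\<close> is \<open>H\<close> and the image of \<open>\<sigma>\<close> is \<open>R\<close>, so \<open>HR\<close> is the whole preimage of \<open>U(n)\<close>; it contains
  the center, which is the preimage of \<open>{1, -1}\<close>. The rest is algebra of central products.\<close>

section \<open>Power series of the inverse square root\<close>

text \<open>H and R are connected components, so identifying them takes a continuous
  \<open>\<alpha>\<close>, not merely a homomorphism: where the determinant is 1,
  \<open>\<alpha>\<close> takes values in the countable set of multiples of 2 pi / n and is
  therefore constant on connected subsets. Multiplicativity reduces continuity to a neighbourhood of
  the identity. There a second deformation, this time inside U(n), joins a matrix to 1 while its
  determinant stays in the right half plane, and the angle is the principal argument divided by n.
  The factor n is forced by the normalisation on \<open>\<sigma>\<close>, because e^(it) id has
  determinant e^(int). Both deformations need a correcting factor that depends continuously on the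
  matrix, is symmetric, and commutes with everything its argument commutes with. The binomial series
  of the inverse square root supplies all three, provided that one bound r < 1 on the operator norm
  holds on the whole parameter set. Homotopies are lifted with the group structure: a lift starting
  at the identity is a finite product of values of a single local section there.\<close>

lemma bounded_bilinear_matrix_mult:
  "bounded_bilinear ((**) :: real^'b^'a \<Rightarrow> real^'c^'b \<Rightarrow> real^'c^'a)"
  unfolding bilinear_conv_bounded_bilinear[symmetric] bilinear_def linear_iff
  by (simp add: matrix_matrix_mult_def vec_eq_iff sum.distrib distrib_left distrib_right
      sum_distrib_left mult.assoc mult.left_commute)

lemmas continuous_on_matrix_mult [continuous_intros] =
  bounded_bilinear.continuous_on [OF bounded_bilinear_matrix_mult]

lemma bounded_linear_transpose: "bounded_linear (transpose :: real^'b^'a \<Rightarrow> real^'a^'b)"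
  by (subst linear_conv_bounded_linear[symmetric])
    (auto simp: linear_iff transpose_def vec_eq_iff)

lemmas continuous_on_transpose [continuous_intros] =
  bounded_linear.continuous_on [OF bounded_linear_transpose]

lemma bounded_bilinear_matrix_vector_mult:
  "bounded_bilinear ((*v) :: real^'b^'a \<Rightarrow> real^'b \<Rightarrow> real^'a)"
  unfolding bilinear_conv_bounded_bilinear[symmetric] bilinear_def linear_iff
  by (simp add: matrix_vector_mult_def vec_eq_iff sum.distrib distrib_left distrib_right
      sum_distrib_left mult.assoc mult.left_commute)

lemmas continuous_on_matrix_vector_mult [continuous_intros] =
  bounded_bilinear.continuous_on [OF bounded_bilinear_matrix_vector_mult]

lemmas mat_mult_minus_left = bounded_bilinear.minus_left [OF bounded_bilinear_matrix_mult]
lemmas mat_mult_minus_right = bounded_bilinear.minus_right [OF bounded_bilinear_matrix_mult]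
lemmas mat_mult_diff_left = bounded_bilinear.diff_left [OF bounded_bilinear_matrix_mult]
lemmas mat_mult_diff_right = bounded_bilinear.diff_right [OF bounded_bilinear_matrix_mult]
lemmas mat_mult_add_left = bounded_bilinear.add_left [OF bounded_bilinear_matrix_mult]
lemmas mat_mult_add_right = bounded_bilinear.add_right [OF bounded_bilinear_matrix_mult]
lemmas mat_mult_scaleR_left = bounded_bilinear.scaleR_left [OF bounded_bilinear_matrix_mult]
lemmas mat_mult_scaleR_right = bounded_bilinear.scaleR_right [OF bounded_bilinear_matrix_mult]

lemmas mat_algebra =
  mat_mult_minus_left mat_mult_minus_right mat_mult_diff_left mat_mult_diff_right
  mat_mult_add_left mat_mult_add_right mat_mult_scaleR_left mat_mult_scaleR_right

primrec matrix_power :: "real^'n^'n \<Rightarrow> nat \<Rightarrow> real^'n^'n" where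
  "matrix_power A 0 = mat 1"
| "matrix_power A (Suc k) = A ** matrix_power A k"

lemma matrix_power_add: "matrix_power A (j + k) = matrix_power A j ** matrix_power A k"
  by (induction j) (simp_all add: matrix_mul_assoc)

lemma matrix_power_commute:
  assumes "A ** B = B ** A"
  shows "A ** matrix_power B k = matrix_power B k ** A"
proof (induction k)
  case (Suc k)
  have "A ** matrix_power B (Suc k) = B ** (A ** matrix_power B k)"
    by (simp add: matrix_mul_assoc assms)
  also have "\<dots> = matrix_power B (Suc k) ** A"
    by (simp add: Suc matrix_mul_assoc)
  finally show ?case .
qed simp

lemma matrix_power_transpose:
  assumes "transpose A = A"
  shows "transpose (matrix_power A k) = matrix_power A k"
proof (induction k)
  case (Suc k)
  then show ?case
    using matrix_power_commute[of A A k] assms by (simp add: matrix_transpose_mul)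
qed simp

lemma continuous_on_matrix_power: "continuous_on S (\<lambda>A. matrix_power A k)"
  by (induction k) (auto intro!: continuous_intros)

text \<open>Operator norm at most \<open>r\<close>, phrased on vectors. One \<open>r\<close> for the
  whole set is what the M-test needs for a uniform majorant r^k.\<close>

definition contractions :: "real \<Rightarrow> (real^'n^'n) set" where
  "contractions r = {A. \<forall>v. norm (A *v v) \<le> r * norm v}"

lemma matrix_power_contraction:
  assumes "A \<in> contractions r" "0 \<le> r"
  shows "norm (matrix_power A k *v v) \<le> r ^ k * norm v"
proof (induction k)
  case (Suc k)
  have "norm (matrix_power A (Suc k) *v v) \<le> r * norm (matrix_power A k *v v)"
    using assms(1) by (simp add: contractions_def flip: matrix_vector_mul_assoc)
  also have "\<dots> \<le> r * (r ^ k * norm v)"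
    using Suc assms(2) by (rule mult_left_mono)
  finally show ?case by (simp add: mult.assoc)
qed simp

lemma matrix_power_nth_le:
  assumes "A \<in> contractions r" "0 \<le> r"
  shows "\<bar>matrix_power A k $ i $ j\<bar> \<le> r ^ k"
proof -
  have "\<bar>matrix_power A k $ i $ j\<bar> = \<bar>(matrix_power A k *v axis j 1) $ i\<bar>"
    by (simp add: matrix_vector_mult_basis column_def)
  also have "\<dots> \<le> norm (matrix_power A k *v axis j 1)"
    by (rule component_le_norm_cart)
  also have "\<dots> \<le> r ^ k"
    using matrix_power_contraction[OF assms, of k "axis j 1"] by simp
  finally show ?thesis .
qed

text \<open>The Taylor coefficients of (1 - x)^(-1/2), equal to the central binomial coefficient of
  2k divided by 4^k.\<close>

definition isqrt_coeff :: "nat \<Rightarrow> real" where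
  "isqrt_coeff k = pochhammer (1/2) k / fact k"

lemma isqrt_coeff_0 [simp]: "isqrt_coeff 0 = 1"
  by (simp add: isqrt_coeff_def)

lemma isqrt_coeff_bounds: "0 \<le> isqrt_coeff k" "isqrt_coeff k \<le> 1"
proof -
  show "0 \<le> isqrt_coeff k"
    by (simp add: isqrt_coeff_def pochhammer_nonneg)
  have "pochhammer (1/2) k \<le> pochhammer (1::real) k"
    unfolding pochhammer_prod by (rule prod_mono) auto
  then show "isqrt_coeff k \<le> 1"
    by (simp add: isqrt_coeff_def flip: pochhammer_fact)
qed

text \<open>Vandermonde's identity for rising factorials at 1/2 + 1/2 = 1. Coefficientwise it says
  that the square of (1 - x)^(-1/2) is the geometric series.\<close>

lemma isqrt_coeff_convolution: "(\<Sum>i\<le>n. isqrt_coeff i * isqrt_coeff (n - i)) = 1"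
proof -
  have "fact n = pochhammer (1/2 + 1/2 :: real) n"
    by (simp flip: pochhammer_fact)
  also have "\<dots> = (\<Sum>i\<le>n. real (n choose i) * pochhammer (1/2) i * pochhammer (1/2) (n - i))"
    by (rule pochhammer_binomial_sum)
  also have "\<dots> = (\<Sum>i\<le>n. fact n * (isqrt_coeff i * isqrt_coeff (n - i)))"
    by (rule sum.cong) (auto simp: isqrt_coeff_def binomial_fact)
  also have "\<dots> = fact n * (\<Sum>i\<le>n. isqrt_coeff i * isqrt_coeff (n - i))"
    by (simp add: sum_distrib_left)
  finally show ?thesis by simp
qed

text \<open>The binomial series of \<open>(1 - A)\<^bsup>-1/2\<^esup>\<close>, summed entrywise.\<close>

definition isqrt :: "real^'n^'n \<Rightarrow> real^'n^'n" where
  "isqrt A = (\<chi> i j. \<Sum>k. isqrt_coeff k * matrix_power A k $ i $ j)"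

lemma isqrt_term_le:
  assumes "A \<in> contractions r" "0 \<le> r"
  shows "\<bar>isqrt_coeff k * matrix_power A k $ i $ j\<bar> \<le> r ^ k"
proof -
  have "\<bar>isqrt_coeff k * matrix_power A k $ i $ j\<bar> \<le> 1 * r ^ k"
    unfolding abs_mult
    by (intro mult_mono matrix_power_nth_le[OF assms]) (use isqrt_coeff_bounds[of k] in auto)
  then show ?thesis by simp
qed

lemma isqrt_summable:
  assumes "A \<in> contractions r" "0 \<le> r" "r < 1"
  shows "summable (\<lambda>k. \<bar>isqrt_coeff k * matrix_power A k $ i $ j\<bar>)"
  by (rule summable_comparison_test'[of "\<lambda>k. r ^ k" 0])
    (use isqrt_term_le[OF assms(1,2)] assms summable_geometric[of r] in auto)

lemma isqrt_sums:
  assumes "A \<in> contractions r" "0 \<le> r" "r < 1"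
  shows "(\<lambda>k. isqrt_coeff k *\<^sub>R matrix_power A k) sums isqrt A"
proof -
  have "(\<lambda>k. isqrt_coeff k * matrix_power A k $ i $ j) sums (isqrt A $ i $ j)" for i j
    unfolding isqrt_def
    using summable_sums[OF summable_rabs_cancel[OF isqrt_summable[OF assms]]] by simp
  then show ?thesis
    unfolding sums_def by (intro vec_tendstoI) simp
qed

text \<open>Multiplication by \<open>B\<close> on either side is bounded linear, so it passes
  through the sum, and \<open>B\<close> commutes with every power of \<open>A\<close>.\<close>

lemma isqrt_commute:
  assumes "A \<in> contractions r" "0 \<le> r" "r < 1" "B ** A = A ** B"
  shows "B ** isqrt A = isqrt A ** B"
proof -
  have "(\<lambda>k. B ** (isqrt_coeff k *\<^sub>R matrix_power A k)) sums (B ** isqrt A)"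
    by (rule bounded_linear.sums[OF
          bounded_bilinear.bounded_linear_right[OF bounded_bilinear_matrix_mult] isqrt_sums])
      (use assms in auto)
  moreover have "(\<lambda>k. (isqrt_coeff k *\<^sub>R matrix_power A k) ** B) sums (isqrt A ** B)"
    by (rule bounded_linear.sums[OF
          bounded_bilinear.bounded_linear_left[OF bounded_bilinear_matrix_mult] isqrt_sums])
      (use assms in auto)
  ultimately show ?thesis
    using matrix_power_commute[OF assms(4)] by (simp add: mat_algebra sums_unique2)
qed

text \<open>Every power of \<open>A\<close> is symmetric, so the entries (i, j) and (j, i) are sums
  of literally the same sequence; convergence does not enter.\<close>

lemma isqrt_transpose:
  assumes "transpose A = A"
  shows "transpose (isqrt A) = isqrt A"
proof -
  have "matrix_power A k $ i $ j = matrix_power A k $ j $ i" for i j k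
    by (subst matrix_power_transpose[OF assms, symmetric]) (simp add: transpose_def)
  then show ?thesis
    by (simp add: isqrt_def transpose_def)
qed

lemma isqrt_0 [simp]: "isqrt (0 :: real^'n^'n) = mat 1"
proof -
  have "matrix_power 0 k = (if k = 0 then mat 1 else 0 :: real^'n^'n)" for k
    by (cases k) simp_all
  then have "(\<Sum>k. isqrt_coeff k * matrix_power 0 k $ i $ j) =
      (\<Sum>k\<in>{0}. isqrt_coeff k * matrix_power 0 k $ i $ (j::'n))" for i j
    by (intro suminf_finite) auto
  then show ?thesis
    by (simp add: isqrt_def vec_eq_iff)
qed

lemma isqrt_continuous_on:
  assumes "0 \<le> r" "r < 1"
  shows "continuous_on (contractions r) (isqrt :: real^'n^'n \<Rightarrow> real^'n^'n)"
proof -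
  have "continuous_on (contractions r)
      (\<lambda>A. \<Sum>k. isqrt_coeff k * matrix_power A k $ i $ j)" for i j :: 'n
  proof (rule uniform_limit_theorem[OF _ Weierstrass_m_test[of _ _ "\<lambda>k. r ^ k"]])
    show "\<forall>\<^sub>F n in sequentially. continuous_on (contractions r)
        (\<lambda>A. \<Sum>k<n. isqrt_coeff k * matrix_power A k $ i $ j)"
      by (intro always_eventually allI continuous_on_sum continuous_on_mult continuous_on_const
          continuous_on_component continuous_on_matrix_power)
  qed (use isqrt_term_le assms summable_geometric[of r] in auto)
  then show ?thesis
    unfolding isqrt_def by (intro continuous_on_vec_lambda)
qed

text \<open>The convolution of the coefficients with themselves is constant, so the square is a geometric series.\<close>

lemma isqrt_square:
  assumes A: "A \<in> contractions r" "0 \<le> r" "r < 1"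
  shows "(\<lambda>k. matrix_power A k) sums (isqrt A ** isqrt A)"
proof -
  have "(\<lambda>k. matrix_power A k $ i $ j) sums ((isqrt A ** isqrt A) $ i $ j)" for i j
  proof -
    define t where "t k i j = isqrt_coeff k * matrix_power A k $ i $ j" for k i j
    have "(\<lambda>k. \<Sum>l\<le>k. t l i m * t (k - l) m j) sums (isqrt A $ i $ m * isqrt A $ m $ j)" for m
      using Cauchy_product_sums[of "\<lambda>k. t k i m" "\<lambda>k. t k m j"] isqrt_summable[OF A]
      by (simp add: t_def isqrt_def)
    then have "(\<lambda>k. \<Sum>m\<in>UNIV. \<Sum>l\<le>k. t l i m * t (k - l) m j)
        sums (\<Sum>m\<in>UNIV. isqrt A $ i $ m * isqrt A $ m $ j)"
      by (intro sums_sum)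
    \<comment> \<open>After exchanging the sums, the sum over \<open>m\<close> forms an entry of A^l
      A^(k-l) = A^k, which does not depend on \<open>l\<close>; only the convolution of the
      coefficients is left.\<close>
    moreover have "(\<Sum>m\<in>UNIV. \<Sum>l\<le>k. t l i m * t (k - l) m j) = matrix_power A k $ i $ j" for k
    proof -
      have "(\<Sum>m\<in>UNIV. \<Sum>l\<le>k. t l i m * t (k - l) m j) =
          (\<Sum>l\<le>k. isqrt_coeff l * isqrt_coeff (k - l) *
             (matrix_power A l ** matrix_power A (k - l)) $ i $ j)"
        unfolding t_def
        by (subst sum.swap)
          (simp add: matrix_matrix_mult_def sum_distrib_left mult.assoc mult.left_commute)
      also have "\<dots> = (\<Sum>l\<le>k. isqrt_coeff l * isqrt_coeff (k - l)) * matrix_power A k $ i $ j"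
        by (simp add: sum_distrib_right flip: matrix_power_add)
      finally show ?thesis
        by (simp add: isqrt_coeff_convolution)
    qed
    ultimately show ?thesis
      by (simp add: matrix_matrix_mult_def)
  qed
  then show ?thesis
    unfolding sums_def by (intro vec_tendstoI) simp
qed

text \<open>The square S is the geometric series in \<open>A\<close>, and shifting its index gives A
  S + 1 = S.\<close>

lemma isqrt_square_inverse:
  assumes A: "A \<in> contractions r" "0 \<le> r" "r < 1"
  shows "(mat 1 - A) ** (isqrt A ** isqrt A) = mat 1"
proof -
  let ?S = "isqrt A ** isqrt A"
  have "(\<lambda>k. A ** matrix_power A k) sums (A ** ?S)"
    by (rule bounded_linear.sums[OF
          bounded_bilinear.bounded_linear_right[OF bounded_bilinear_matrix_mult] isqrt_square[OF A]])
  then have "(\<lambda>k. matrix_power A (Suc k)) sums (A ** ?S)"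
    by simp
  then have "(\<lambda>k. matrix_power A k) sums (A ** ?S + matrix_power A 0)"
    by (rule sums_Suc)
  from sums_unique2[OF this isqrt_square[OF A]] have "A ** ?S + mat 1 = ?S"
    by simp
  then show ?thesis
    by (simp add: mat_algebra algebra_simps)
qed


section \<open>Symplectic matrices and their complex linear parts\<close>

lemma sum_UNIV_Plus: "sum f (UNIV :: ('a::finite + 'b::finite) set) = (\<Sum>i\<in>UNIV. f (Inl i)) + (\<Sum>i\<in>UNIV. f (Inr i))"
  unfolding UNIV_Plus_UNIV[symmetric] by (subst sum.Plus) (auto simp: sum.Plus)

lemma block_nth [simp]:
  "block A B C D $ Inl i $ Inl j = A $ i $ j"
  "block A B C D $ Inl i $ Inr j = B $ i $ j"
  "block A B C D $ Inr i $ Inl j = C $ i $ j"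
  "block A B C D $ Inr i $ Inr j = D $ i $ j"
  by (simp_all add: block_def)

lemma vec_eq_iff_Plus:
  fixes M N :: "'a^('n::finite + 'n)^('n + 'n)"
  shows "M = N \<longleftrightarrow> (\<forall>i j. M $ Inl i $ Inl j = N $ Inl i $ Inl j \<and> M $ Inl i $ Inr j = N $ Inl i $ Inr j
     \<and> M $ Inr i $ Inl j = N $ Inr i $ Inl j \<and> M $ Inr i $ Inr j = N $ Inr i $ Inr j)"
  unfolding vec_eq_iff by (metis sum.exhaust)

lemma block_eq_iff: "block A B C D = block A' B' C' D' \<longleftrightarrow> A = A' \<and> B = B' \<and> C = C' \<and> D = D'"
  unfolding vec_eq_iff_Plus by (auto simp: vec_eq_iff)

lemma block_cases:
  fixes M :: "'a^('n::finite + 'n)^('n + 'n)"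
  obtains A B C D where "M = block A B C D"
proof
  show "M = block (\<chi> i j. M $ Inl i $ Inl j) (\<chi> i j. M $ Inl i $ Inr j)
     (\<chi> i j. M $ Inr i $ Inl j) (\<chi> i j. M $ Inr i $ Inr j)"
    by (simp add: vec_eq_iff_Plus)
qed

lemma block_mult:
  "block A B C D ** block A' B' C' D' =
   block (A ** A' + B ** C') (A ** B' + B ** D') (C ** A' + D ** C') (C ** B' + D ** D')"
  by (simp add: vec_eq_iff_Plus matrix_matrix_mult_def sum_UNIV_Plus)

lemma transpose_block:
  "transpose (block A B C D) = block (transpose A) (transpose C) (transpose B) (transpose D)"
  by (simp add: vec_eq_iff_Plus transpose_def)

lemma mat_block: "mat c = block (mat c) 0 0 (mat c)"
  by (simp add: vec_eq_iff_Plus mat_def)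

lemma uminus_block: "- block A B C D = block (- A) (- B) (- C) (- D)"
  by (simp add: vec_eq_iff_Plus)

lemmas transpose_uminus = linear_neg[OF bounded_linear.linear[OF bounded_linear_transpose]]

lemmas transpose_linear =
  linear_diff[OF bounded_linear.linear[OF bounded_linear_transpose]]
  linear_add[OF bounded_linear.linear[OF bounded_linear_transpose]]
  transpose_uminus
  linear_scale[OF bounded_linear.linear[OF bounded_linear_transpose]]

lemma transpose_zero [simp]: "transpose (0 :: 'a::zero^'m^'n) = 0"
  by (simp add: transpose_def vec_eq_iff)

lemma Omega_mult_Omega: "Omega ** Omega = - mat 1"
  by (simp add: Omega_def block_mult mat_mult_minus_left mat_mult_minus_right mat_block uminus_block)

lemma transpose_Omega: "transpose Omega = - Omega"
  by (simp add: Omega_def transpose_block uminus_block transpose_uminus)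

lemma Omega_mult_cancel: "Omega ** (Omega ** A) = - A" "A ** Omega ** Omega = - A"
proof -
  show "Omega ** (Omega ** A) = - A"
    by (simp add: matrix_mul_assoc Omega_mult_Omega mat_mult_minus_left)
  show "A ** Omega ** Omega = - A"
    by (simp add: Omega_mult_Omega mat_mult_minus_right flip: matrix_mul_assoc)
qed

lemma Sp_carrier_iff: "M \<in> carrier Sp \<longleftrightarrow> transpose M ** Omega ** M = Omega"
  by (simp add: Sp_def)

lemma Sp_simps [simp]: "x \<otimes>\<^bsub>Sp\<^esub> y = x ** y" "\<one>\<^bsub>Sp\<^esub> = mat 1"
  by (simp_all add: Sp_def)

lemma Sp_mult_closed:
  assumes "M \<in> carrier Sp" "N \<in> carrier Sp"
  shows "M ** N \<in> carrier Sp"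
proof -
  have "transpose (M ** N) ** Omega ** (M ** N) =
      transpose N ** (transpose M ** Omega ** M) ** N"
    by (simp add: matrix_transpose_mul matrix_mul_assoc)
  then show ?thesis
    using assms by (simp add: Sp_carrier_iff)
qed

text \<open>Solving the defining relation for the inverse of \<open>M\<close>, with
  \<open>- Omega\<close> as the inverse of \<open>Omega\<close>. The formula is linear in
  \<open>M\<close>, so inversion is visibly continuous.\<close>

definition Sp_inverse :: "real^('n::finite + 'n)^('n + 'n) \<Rightarrow> real^('n + 'n)^('n + 'n)" where
  "Sp_inverse M = - (Omega ** transpose M ** Omega)"

lemma Sp_inverse_mult:
  assumes "M \<in> carrier Sp"
  shows "Sp_inverse M ** M = mat 1" "M ** Sp_inverse M = mat 1"
proof -
  have "Sp_inverse M ** M = - (Omega ** (transpose M ** Omega ** M))"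
    by (simp add: Sp_inverse_def mat_mult_minus_left matrix_mul_assoc)
  also have "\<dots> = mat 1"
    using assms by (simp add: Sp_carrier_iff Omega_mult_Omega)
  finally show "Sp_inverse M ** M = mat 1" .
  then show "M ** Sp_inverse M = mat 1"
    by (simp add: matrix_left_right_inverse)
qed

lemma Sp_inverse_closed:
  assumes "M \<in> carrier Sp"
  shows "Sp_inverse M \<in> carrier Sp"
proof -
  let ?N = "Sp_inverse M"
  have "transpose ?N ** Omega ** ?N = transpose ?N ** (transpose M ** Omega ** M) ** ?N"
    using assms by (simp add: Sp_carrier_iff)
  also have "\<dots> = transpose (M ** ?N) ** Omega ** (M ** ?N)"
    by (simp add: matrix_transpose_mul matrix_mul_assoc)
  finally show ?thesis
    by (simp add: Sp_inverse_mult(2)[OF assms] Sp_carrier_iff)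
qed

lemma Sp_one_closed: "mat 1 \<in> carrier Sp"
  by (simp add: Sp_carrier_iff)

lemma Sp_group: "Group.group Sp"
proof (rule groupI)
  fix x :: "real^('n::finite + 'n)^('n + 'n)" assume "x \<in> carrier Sp"
  then show "\<exists>y\<in>carrier Sp. y \<otimes>\<^bsub>Sp\<^esub> x = \<one>\<^bsub>Sp\<^esub>"
    using Sp_inverse_mult Sp_inverse_closed by (auto intro!: bexI[of _ "Sp_inverse x"])
qed (auto simp: Sp_mult_closed Sp_one_closed matrix_mul_assoc)

lemma Sp_inv_eq: "M \<in> carrier Sp \<Longrightarrow> inv\<^bsub>Sp\<^esub> M = Sp_inverse M"
  using group.inv_equality[OF Sp_group] Sp_inverse_mult Sp_inverse_closed by force

lemma continuous_on_Sp_inverse [continuous_intros]: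
  "continuous_on S f \<Longrightarrow> continuous_on S (\<lambda>x. Sp_inverse (f x))"
  unfolding Sp_inverse_def by (intro continuous_intros)

lemma uminus_Sp_closed: "M \<in> carrier Sp \<Longrightarrow> - M \<in> carrier Sp"
  by (simp add: Sp_carrier_iff transpose_uminus mat_algebra)

section \<open>U(n) as the matrices in Sp commuting with Omega\<close>

text \<open>The image of the unitary group consists of the symplectic matrices commuting with \<open>Omega\<close>.\<close>

definition unitary_part :: "(real^('n::finite + 'n)^('n + 'n)) set" where
  "unitary_part = {M \<in> carrier Sp. M ** Omega = Omega ** M}"

text \<open>Reads A + iB off the first block column only. It is a left inverse of
  \<open>unitary_embedding\<close>, and inverts it on the other side exactly for matrices commuting
  with \<open>Omega\<close>.\<close>

definition complex_matrix :: "real^('n::finite + 'n)^('n + 'n) \<Rightarrow> complex^'n^'n" where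
  "complex_matrix M = (\<chi> i j. Complex (M $ Inl i $ Inl j) (M $ Inr i $ Inl j))"

lemma unitary_embedding_block:
  "unitary_embedding U = block (\<chi> i j. Re (U $ i $ j)) (- (\<chi> i j. Im (U $ i $ j)))
     (\<chi> i j. Im (U $ i $ j)) (\<chi> i j. Re (U $ i $ j))"
  by (simp add: unitary_embedding_def Let_def)

lemma complex_matrix_unitary_embedding [simp]: "complex_matrix (unitary_embedding U) = U"
  by (simp add: complex_matrix_def unitary_embedding_block vec_eq_iff complex_eq_iff)

lemma commute_Omega_iff:
  "block A B C D ** Omega = Omega ** block A B C D \<longleftrightarrow> A = D \<and> C = - B"
  by (auto simp: Omega_def block_mult block_eq_iff mat_algebra)

lemma unitary_embedding_commute: "unitary_embedding U ** Omega = Omega ** unitary_embedding U"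
  by (simp add: unitary_embedding_block commute_Omega_iff)

lemma unitary_embedding_complex_matrix:
  assumes "M ** Omega = Omega ** M"
  shows "unitary_embedding (complex_matrix M) = M"
proof (cases M rule: block_cases)
  case (1 A B C D)
  with assms show ?thesis
    by (simp add: commute_Omega_iff complex_matrix_def unitary_embedding_block block_eq_iff)
      (simp add: vec_eq_iff)
qed

lemma unitary_embedding_mult:
  "unitary_embedding (U ** V) = unitary_embedding U ** unitary_embedding V"
  unfolding unitary_embedding_block block_mult block_eq_iff
  by (simp add: vec_eq_iff matrix_matrix_mult_def sum_subtractf sum_negf sum.distrib mult.commute)

lemma unitary_embedding_mat:
  "unitary_embedding (mat c) = block (mat (Re c)) (- mat (Im c)) (mat (Im c)) (mat (Re c))"
  unfolding unitary_embedding_block block_eq_iff by (auto simp: vec_eq_iff mat_def)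

lemma unitary_embedding_1 [simp]: "unitary_embedding (mat 1) = mat 1"
  unfolding unitary_embedding_mat mat_block[of "1::real"] block_eq_iff
  by (simp add: vec_eq_iff mat_def)

lemma unitary_embedding_adjoint:
  "unitary_embedding (adjoint_matrix U) = transpose (unitary_embedding U)"
  unfolding unitary_embedding_block transpose_block block_eq_iff
  by (simp add: vec_eq_iff adjoint_matrix_def transpose_def)

lemma unitary_embedding_inject: "unitary_embedding U = unitary_embedding V \<longleftrightarrow> U = V"
  by (metis complex_matrix_unitary_embedding)

text \<open>An instance of the two-out-of-three property of the unitary group: once
  \<open>Omega\<close> has been moved past \<open>M\<close>, it cancels.\<close>

lemma commute_Omega_symplectic:
  assumes "M ** Omega = Omega ** M"
  shows "M \<in> carrier Sp \<longleftrightarrow> transpose M ** M = mat 1"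
proof -
  have "transpose M ** Omega ** M = transpose M ** M ** Omega"
    by (simp add: assms flip: matrix_mul_assoc)
  then have "M \<in> carrier Sp \<longleftrightarrow> transpose M ** M ** Omega = Omega"
    by (simp add: Sp_carrier_iff)
  also have "\<dots> \<longleftrightarrow> transpose M ** M = mat 1"
    by (metis Omega_mult_cancel(2) matrix_mul_lid neg_equal_iff_equal)
  finally show ?thesis .
qed

lemma unitary_embedding_in_Sp_iff: "unitary_embedding U \<in> carrier Sp \<longleftrightarrow> U \<in> unitary_matrices"
  unfolding commute_Omega_symplectic[OF unitary_embedding_commute] unitary_matrices_def
  by (simp add: unitary_embedding_inject[of _ "mat 1", simplified]
      flip: unitary_embedding_adjoint unitary_embedding_mult)

lemma unitary_part_eq: "unitary_part = unitary_embedding ` unitary_matrices"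
proof (intro equalityI subsetI)
  fix M :: "real^('n::finite + 'n)^('n + 'n)"
  assume "M \<in> unitary_part"
  then show "M \<in> unitary_embedding ` unitary_matrices"
    unfolding unitary_part_def
    by (metis (mono_tags, lifting) image_eqI mem_Collect_eq unitary_embedding_complex_matrix
        unitary_embedding_in_Sp_iff)
qed (auto simp: unitary_part_def unitary_embedding_in_Sp_iff unitary_embedding_commute)

lemma unitary_part_mult: "M \<in> unitary_part \<Longrightarrow> N \<in> unitary_part \<Longrightarrow> M ** N \<in> unitary_part"
  unfolding unitary_part_def by (auto simp: Sp_mult_closed) (metis matrix_mul_assoc)

lemma commute_Omega_transpose:
  assumes "M ** Omega = Omega ** M"
  shows "transpose M ** Omega = Omega ** transpose M"
proof -
  have "transpose (M ** Omega) = transpose (Omega ** M)"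
    by (simp add: assms)
  then show ?thesis
    by (simp add: matrix_transpose_mul transpose_Omega mat_algebra)
qed

lemma unitary_part_inverse: "M \<in> unitary_part \<Longrightarrow> Sp_inverse M \<in> unitary_part"
proof -
  assume M: "M \<in> unitary_part"
  then have "transpose M ** Omega = Omega ** transpose M"
    by (simp add: unitary_part_def commute_Omega_transpose)
  then have "Sp_inverse M = transpose M"
    by (simp add: Sp_inverse_def Omega_mult_cancel flip: matrix_mul_assoc)
  with M show ?thesis
    using Sp_inverse_closed[of M] commute_Omega_transpose[of M] by (simp add: unitary_part_def)
qed

text \<open>Since \<open>- Omega\<close> is the inverse of \<open>Omega\<close>, conjugation by
  \<open>Omega\<close> sends \<open>M\<close> to \<open>- (Omega ** M ** Omega)\<close>. This and
  the next definition are the projections onto the eigenspaces of this involution for 1 and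
  -1.\<close>

definition clinear_part :: "real^('n::finite + 'n)^('n + 'n) \<Rightarrow> real^('n + 'n)^('n + 'n)" where
  "clinear_part M = (1/2) *\<^sub>R (M - Omega ** M ** Omega)"

definition antilinear_part :: "real^('n::finite + 'n)^('n + 'n) \<Rightarrow> real^('n + 'n)^('n + 'n)" where
  "antilinear_part M = (1/2) *\<^sub>R (M + Omega ** M ** Omega)"

lemma parts_sum: "clinear_part M + antilinear_part M = M"
  by (simp add: clinear_part_def antilinear_part_def vec_eq_iff field_simps)

lemma parts_diff: "clinear_part M - antilinear_part M = - (Omega ** M ** Omega)"
  by (simp add: clinear_part_def antilinear_part_def vec_eq_iff field_simps)

lemma clinear_part_commute: "clinear_part M ** Omega = Omega ** clinear_part M"
  by (simp add: clinear_part_def mat_algebra Omega_mult_cancel flip: matrix_mul_assoc)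
    (simp add: matrix_mul_assoc Omega_mult_cancel Omega_mult_Omega mat_algebra)

lemma antilinear_part_anticommute: "antilinear_part M ** Omega = - (Omega ** antilinear_part M)"
  by (simp add: antilinear_part_def mat_algebra Omega_mult_cancel flip: matrix_mul_assoc)
    (simp add: matrix_mul_assoc Omega_mult_cancel Omega_mult_Omega mat_algebra
      flip: scaleR_minus_right)

lemma commute_Omega_parts:
  assumes "M ** Omega = Omega ** M"
  shows "clinear_part M = M" "antilinear_part M = 0"
proof -
  have "Omega ** M ** Omega = - M"
    using assms by (metis Omega_mult_cancel(2))
  then show "clinear_part M = M" "antilinear_part M = 0"
    by (simp_all add: clinear_part_def antilinear_part_def flip: scaleR_2)
qed

context
  fixes M :: "real^('n::finite + 'n)^('n + 'n)"
  assumes M: "M \<in> carrier Sp"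
begin

text \<open>As X - Y is the conjugate of M = X + Y by \<open>Omega\<close>, the symplectic relation
  reads (X^T + Y^T)(X - Y) = 1. Transposing changes the sign of the mixed terms only, so adding and
  subtracting the two equations separates pure from mixed terms.\<close>

lemma Sp_parts:
  "transpose (clinear_part M) ** clinear_part M - transpose (antilinear_part M) ** antilinear_part M = mat 1"
  "transpose (clinear_part M) ** antilinear_part M = transpose (antilinear_part M) ** clinear_part M"
proof -
  let ?X = "clinear_part M" and ?Y = "antilinear_part M"
  have "transpose M ** (?X - ?Y) = - (transpose M ** Omega ** M ** Omega)"
    by (simp add: parts_diff mat_algebra matrix_mul_assoc)
  also have "\<dots> = mat 1"
    using M by (simp add: Sp_carrier_iff Omega_mult_Omega)
  finally have 1: "(transpose ?X + transpose ?Y) ** (?X - ?Y) = mat 1"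
    by (metis parts_sum transpose_linear(2))
  then have "transpose ((transpose ?X + transpose ?Y) ** (?X - ?Y)) = mat 1"
    by simp
  then have 2: "(transpose ?X - transpose ?Y) ** (?X + ?Y) = mat 1"
    by (simp add: matrix_transpose_mul transpose_linear)
  define a b c d where "a = transpose ?X ** ?X" and "b = transpose ?Y ** ?Y"
    and "c = transpose ?X ** ?Y" and "d = transpose ?Y ** ?X"
  have "a - b - (c - d) = mat 1" "a - b + (c - d) = mat 1"
    using 1 2 by (simp_all add: mat_algebra a_def b_def c_def d_def algebra_simps)
  note * = this
  have "2 *\<^sub>R (c - d) = (a - b + (c - d)) - (a - b - (c - d))"
    by (simp add: scaleR_2)
  also have "\<dots> = 0"
    by (simp only: * diff_self)
  finally have "c - d = 0"
    by simp
  with * show "transpose ?X ** ?X - transpose ?Y ** ?Y = mat 1"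
     "transpose ?X ** ?Y = transpose ?Y ** ?X"
    unfolding a_def b_def c_def d_def by simp_all
qed

text \<open>The first identity of \<open>Sp_parts\<close> as an equality of quadratic forms. It
  shows that X does not decrease norms, hence has trivial kernel.\<close>

lemma norm_clinear_part:
  "(norm (clinear_part M *v v))\<^sup>2 = (norm v)\<^sup>2 + (norm (antilinear_part M *v v))\<^sup>2"
proof -
  have *: "v \<bullet> ((transpose A ** A) *v v) = (norm (A *v v))\<^sup>2" for A :: "real^('n + 'n)^('n + 'n)"
    by (simp add: power2_norm_eq_inner dot_lmul_matrix inner_commute[of v]
        flip: matrix_vector_mul_assoc)
  have "v \<bullet> ((transpose (clinear_part M) ** clinear_part M -
       transpose (antilinear_part M) ** antilinear_part M) *v v) = v \<bullet> v"
    by (simp add: Sp_parts)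
  then show ?thesis
    by (simp add: matrix_vector_mult_diff_rdistrib inner_diff_right * power2_norm_eq_inner[of v])
qed

lemma invertible_clinear_part: "invertible (clinear_part M)"
proof -
  have "v = 0" if "clinear_part M *v v = 0" for v
    using norm_clinear_part[of v] that by (simp add: add_nonneg_eq_0_iff)
  then show ?thesis
    by (auto simp: invertible_left_inverse matrix_left_invertible_ker)
qed

end

lemma matrix_inv_mult:
  fixes A :: "real^'n^'n"
  assumes "invertible A"
  shows "matrix_inv A ** A = mat 1" "A ** matrix_inv A = mat 1"
  using assms unfolding invertible_def matrix_inv_def by (metis (mono_tags, lifting) someI_ex)+

lemma continuous_on_det [continuous_intros]:
  fixes f :: "'a::topological_space \<Rightarrow> ('b::real_normed_field)^'n^'n"
  assumes "continuous_on S f"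
  shows "continuous_on S (\<lambda>x. det (f x))"
  unfolding det_def by (intro continuous_intros assms)

text \<open>Cramer's rule for each column. The inverse becomes a quotient of polynomials in the
  entries, which yields its continuity.\<close>

lemma matrix_inv_nth:
  fixes A :: "real^'n^'n"
  assumes "invertible A"
  shows "matrix_inv A $ i $ j = det (\<chi> k l. if l = i then axis j 1 $ k else A $ k $ l) / det A"
proof -
  have "A *v (matrix_inv A *v axis j 1) = axis j 1"
    by (simp add: matrix_vector_mul_assoc matrix_inv_mult assms)
  then have "matrix_inv A *v axis j 1 =
      (\<chi> i. det (\<chi> k l. if l = i then axis j 1 $ k else A $ k $ l) / det A)"
    using cramer[of A] assms by (simp add: invertible_det_nz)
  then show ?thesis
    by (simp add: matrix_vector_mult_basis column_def vec_eq_iff)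
qed

lemma continuous_on_matrix_inv [continuous_intros]:
  fixes f :: "'a::topological_space \<Rightarrow> real^'n^'n"
  assumes "continuous_on S f" "\<And>x. x \<in> S \<Longrightarrow> invertible (f x)"
  shows "continuous_on S (\<lambda>x. matrix_inv (f x))"
proof -
  have "continuous_on S (\<lambda>x. if l = i then axis j 1 $ k else f x $ k $ l)" for i j k l :: 'n
    by (cases "l = i") (auto intro!: continuous_intros assms)
  then have "continuous_on S (\<lambda>x. \<chi> i j.
      det (\<chi> k l. if l = i then axis j 1 $ k else f x $ k $ l) / det (f x))"
    using assms(2) by (intro continuous_intros continuous_on_vec_lambda assms)
      (auto simp: invertible_det_nz)
  then show ?thesis
    by (rule continuous_on_eq) (simp add: vec_eq_iff matrix_inv_nth assms)
qed

text \<open>The coordinate of \<open>M U(n)\<close> in the bounded model of the Siegel domain.\<close>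

definition siegel :: "real^('n::finite + 'n)^('n + 'n) \<Rightarrow> real^('n + 'n)^('n + 'n)" where
  "siegel M = antilinear_part M ** matrix_inv (clinear_part M)"

lemma continuous_on_parts [continuous_intros]:
  assumes "continuous_on S f"
  shows "continuous_on S (\<lambda>x. clinear_part (f x))" "continuous_on S (\<lambda>x. antilinear_part (f x))"
  unfolding clinear_part_def antilinear_part_def by (intro continuous_intros assms)+

lemma continuous_on_siegel [continuous_intros]:
  assumes "continuous_on S f" "f ` S \<subseteq> carrier Sp"
  shows "continuous_on S (\<lambda>x. siegel (f x))"
  unfolding siegel_def using assms
  by (intro continuous_intros) (auto intro: invertible_clinear_part)

lemma siegel_unitary: "M \<in> unitary_part \<Longrightarrow> siegel M = 0"
  by (simp add: siegel_def unitary_part_def commute_Omega_parts)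

context
  fixes M :: "real^('n::finite + 'n)^('n + 'n)"
  assumes M: "M \<in> carrier Sp"
begin

lemma siegel_mult: "siegel M ** clinear_part M = antilinear_part M"
  using invertible_clinear_part[OF M]
  by (simp add: siegel_def matrix_inv_mult flip: matrix_mul_assoc)

lemma siegel_decomp: "M = (mat 1 + siegel M) ** clinear_part M"
  by (simp add: mat_algebra siegel_mult parts_sum)

text \<open>With X and Y the two parts of \<open>M\<close>, the transpose is X^-T (Y^T X) X^-1;
  replacing Y^T X by X^T Y, the second identity of \<open>Sp_parts\<close>, cancels X^-T against
  X^T.\<close>

lemma siegel_symmetric: "transpose (siegel M) = siegel M"
proof -
  let ?X = "clinear_part M" and ?Y = "antilinear_part M"
  note inv = matrix_inv_mult[OF invertible_clinear_part[OF M]]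
  have t: "transpose (matrix_inv ?X) ** transpose ?X = mat 1"
    by (metis inv(2) matrix_transpose_mul transpose_mat)
  have "transpose (siegel M) = transpose (matrix_inv ?X) ** (transpose ?Y ** ?X) ** matrix_inv ?X"
    by (simp add: siegel_def matrix_transpose_mul inv flip: matrix_mul_assoc)
  also have "\<dots> = (transpose (matrix_inv ?X) ** transpose ?X) ** (?Y ** matrix_inv ?X)"
    by (simp add: matrix_mul_assoc flip: Sp_parts(2)[OF M])
  finally show ?thesis
    by (simp add: t siegel_def)
qed

lemma siegel_anticommute: "siegel M ** Omega = - (Omega ** siegel M)"
proof -
  let ?X = "clinear_part M"
  note inv = matrix_inv_mult[OF invertible_clinear_part[OF M]]
  have "matrix_inv ?X ** Omega = matrix_inv ?X ** (Omega ** ?X) ** matrix_inv ?X"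
    by (simp add: inv flip: matrix_mul_assoc)
  also have "\<dots> = Omega ** matrix_inv ?X"
    by (simp add: inv matrix_mul_assoc flip: clinear_part_commute)
  finally have "siegel M ** Omega = antilinear_part M ** Omega ** matrix_inv ?X"
    by (simp add: siegel_def flip: matrix_mul_assoc)
  then show ?thesis
    by (simp add: antilinear_part_anticommute siegel_def mat_algebra matrix_mul_assoc)
qed

text \<open>For w = X^-1 v, the square of the norm of W v = Y w is that of v = X w minus that of w,
  and w is nonzero.\<close>

lemma siegel_norm_less:
  assumes "v \<noteq> 0"
  shows "norm (siegel M *v v) < norm v"
proof -
  let ?X = "clinear_part M"
  define w where "w = matrix_inv ?X *v v"
  have v: "?X *v w = v"
    by (simp add: w_def matrix_vector_mul_assoc matrix_inv_mult invertible_clinear_part[OF M])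
  with assms have "w \<noteq> 0" by auto
  moreover have "siegel M *v v = antilinear_part M *v w"
    by (simp add: siegel_def w_def matrix_vector_mul_assoc)
  ultimately have "(norm (siegel M *v v))\<^sup>2 < (norm v)\<^sup>2"
    using norm_clinear_part[OF M, of w] v by simp
  then show ?thesis
    by (rule power_less_imp_less_base) simp
qed

end


section \<open>Polar decomposition and the determinant\<close>

text \<open>For s = 1 and W = \<open>siegel M\<close> this inverts the positive factor of the polar
  decomposition: M M^T = (1 + W)(1 - W)^-1, whose inverse square root is (1 - W)(1 - W^2)^(-1/2).
  The parameter \<open>s\<close> shrinks W linearly to 0.\<close>

definition polar_inverse ::
  "real \<Rightarrow> real^('n::finite + 'n)^('n + 'n) \<Rightarrow> real^('n + 'n)^('n + 'n)" where
  "polar_inverse s W = (mat 1 - s *\<^sub>R W) ** isqrt (s\<^sup>2 *\<^sub>R (W ** W))"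

lemma contractions_square:
  assumes "W \<in> contractions r" "0 \<le> r" "r < 1" "0 \<le> s" "s \<le> 1"
  shows "s\<^sup>2 *\<^sub>R (W ** W) \<in> contractions r"
  unfolding contractions_def
proof (rule CollectI, rule allI)
  fix v
  have "norm (W *v (W *v v)) \<le> r * norm (W *v v)" "norm (W *v v) \<le> r * norm v"
    using assms(1) by (simp_all add: contractions_def)
  then have "norm (W *v (W *v v)) \<le> r * (r * norm v)"
    using assms(2) by (meson mult_left_mono order_trans)
  also have "\<dots> \<le> 1 * (r * norm v)"
    using assms by (intro mult_right_mono) auto
  finally have "s\<^sup>2 * norm (W *v (W *v v)) \<le> 1 * (r * norm v)"
    using assms by (intro mult_mono) (auto simp: power_le_one)
  then show "norm ((s\<^sup>2 *\<^sub>R (W ** W)) *v v) \<le> r * norm v"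
    by (simp add: matrix_vector_mul_assoc flip: scaleR_matrix_vector_assoc)
qed

lemma anticommute_square:
  assumes "W ** Omega = - (Omega ** W)"
  shows "Omega ** (W ** W) = W ** W ** Omega"
proof -
  have "W ** W ** Omega = - (W ** Omega ** W)"
    by (metis assms mat_mult_minus_right matrix_mul_assoc)
  also have "\<dots> = Omega ** (W ** W)"
    unfolding assms by (simp add: mat_algebra matrix_mul_assoc)
  finally show ?thesis ..
qed

text \<open>Moving \<open>Omega\<close> across 1 - sW turns it into 1 + sW, because W anticommutes
  with \<open>Omega\<close>. The product (1 + sW)(1 - sW) = 1 - s^2 W^2 is then cancelled by the two
  inverse square roots.\<close>

lemma polar_inverse_in_Sp:
  fixes W :: "real^('n::finite + 'n)^('n + 'n)"
  assumes W: "W \<in> contractions r" "0 \<le> r" "r < 1" "0 \<le> s" "s \<le> 1"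
    and sym: "transpose W = W" and anti: "W ** Omega = - (Omega ** W)"
  shows "polar_inverse s W \<in> carrier Sp"
proof -
  let ?Z = "s\<^sup>2 *\<^sub>R (W ** W)"
  let ?D = "isqrt ?Z" and ?V = "s *\<^sub>R W"
  note Z = contractions_square[OF W]
  have "transpose ?D = ?D"
    by (rule isqrt_transpose) (simp add: transpose_linear matrix_transpose_mul sym)
  then have t: "transpose (polar_inverse s W) = ?D ** (mat 1 - ?V)"
    by (simp add: polar_inverse_def matrix_transpose_mul transpose_linear sym)
  have "Omega ** ?Z = ?Z ** Omega"
    by (simp add: mat_algebra anticommute_square[OF anti])
  note O = isqrt_commute[OF Z W(2,3) this]
  have "(mat 1 - ?Z) ** ?Z = ?Z ** (mat 1 - ?Z)"
    by (simp only: mat_mult_diff_left mat_mult_diff_right matrix_mul_lid matrix_mul_rid)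
  note C = isqrt_commute[OF Z W(2,3) this]
  have 1: "(mat 1 - ?V) ** Omega = Omega ** (mat 1 + ?V)"
    by (simp add: mat_algebra anti)
  have 2: "(mat 1 + ?V) ** (mat 1 - ?V) = mat 1 - ?Z"
    by (simp add: mat_algebra power2_eq_square scaleR_add_right)
  have "transpose (polar_inverse s W) ** Omega ** polar_inverse s W =
      ?D ** ((mat 1 - ?V) ** Omega) ** (mat 1 - ?V) ** ?D"
    unfolding t by (simp add: polar_inverse_def matrix_mul_assoc)
  also have "\<dots> = (?D ** Omega) ** ((mat 1 + ?V) ** (mat 1 - ?V)) ** ?D"
    unfolding 1 by (simp only: matrix_mul_assoc)
  also have "\<dots> = Omega ** (?D ** (mat 1 - ?Z)) ** ?D"
    unfolding 2 O[symmetric] by (simp only: matrix_mul_assoc)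
  also have "\<dots> = Omega ** ((mat 1 - ?Z) ** (?D ** ?D))"
    unfolding C[symmetric] by (simp only: matrix_mul_assoc)
  also have "\<dots> = Omega"
    by (simp add: isqrt_square_inverse[OF Z W(2,3)])
  finally show ?thesis
    by (simp add: Sp_carrier_iff)
qed

text \<open>Using M = (1 + W) X, the product equals (1 - W^2)(1 - W^2)^(-1/2) X. Only even powers of
  W remain, and these commute with \<open>Omega\<close> just as X does.\<close>

lemma polar_inverse_siegel:
  fixes M :: "real^('n::finite + 'n)^('n + 'n)"
  assumes M: "M \<in> carrier Sp" and r: "siegel M \<in> contractions r" "0 \<le> r" "r < 1"
  shows "polar_inverse 1 (siegel M) ** M \<in> unitary_part"
proof -
  let ?W = "siegel M" and ?X = "clinear_part M"
  let ?D = "isqrt (?W ** ?W)"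
  have Z: "?W ** ?W \<in> contractions r"
    using contractions_square[OF r, of 1] by simp
  have "polar_inverse 1 ?W ** M = (mat 1 - ?W) ** ?D ** ((mat 1 + ?W) ** ?X)"
    using siegel_decomp[OF M] by (simp add: polar_inverse_def)
  also have "\<dots> = (mat 1 - ?W) ** (?D ** (mat 1 + ?W)) ** ?X"
    by (simp add: matrix_mul_assoc)
  also have "?D ** (mat 1 + ?W) = (mat 1 + ?W) ** ?D"
    by (rule isqrt_commute[OF Z r(2,3), symmetric]) (simp add: mat_algebra matrix_mul_assoc)
  also have "(mat 1 - ?W) ** ((mat 1 + ?W) ** ?D) = (mat 1 - ?W ** ?W) ** ?D"
    by (simp add: mat_algebra matrix_mul_assoc)
  finally have eq: "polar_inverse 1 ?W ** M = (mat 1 - ?W ** ?W) ** ?D ** ?X" .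
  note O = anticommute_square[OF siegel_anticommute[OF M]]
  have "(mat 1 - ?W ** ?W) ** ?D ** ?X ** Omega = (mat 1 - ?W ** ?W) ** (?D ** Omega) ** ?X"
    by (simp add: clinear_part_commute flip: matrix_mul_assoc)
  also have "\<dots> = ((mat 1 - ?W ** ?W) ** Omega) ** ?D ** ?X"
    by (simp only: isqrt_commute[OF Z r(2,3) O, symmetric] matrix_mul_assoc)
  also have "(mat 1 - ?W ** ?W) ** Omega = Omega ** (mat 1 - ?W ** ?W)"
    by (simp add: mat_algebra O)
  finally have "polar_inverse 1 ?W ** M ** Omega = Omega ** (polar_inverse 1 ?W ** M)"
    by (simp add: eq matrix_mul_assoc)
  moreover have "polar_inverse 1 ?W ** M \<in> carrier Sp"
    using polar_inverse_in_Sp[OF r] siegel_symmetric[OF M] siegel_anticommute[OF M] M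
    by (intro Sp_mult_closed) auto
  ultimately show ?thesis
    by (simp add: unitary_part_def)
qed

text \<open>The pointwise strict inequality attains its worst case on the compact product of
  \<open>K\<close> with the unit sphere. A uniform \<open>r\<close> is required because
  \<open>isqrt\<close> is known to be continuous only on \<open>contractions r\<close> with fixed r
  < 1.\<close>

lemma siegel_uniform_contraction:
  fixes f :: "'b::metric_space \<Rightarrow> real^('n::finite + 'n)^('n + 'n)"
  assumes "compact K" "continuous_on K f" "f ` K \<subseteq> carrier Sp"
  obtains r where "0 \<le> r" "r < 1" "\<And>y. y \<in> K \<Longrightarrow> siegel (f y) \<in> contractions r"
proof (cases "K = {}")
  case True
  then show ?thesis using that[of 0] by auto
next
  case False
  let ?S = "sphere (0 :: real^('n + 'n)) 1"
  let ?g = "\<lambda>(y, v). norm (siegel (f y) *v v)"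
  have ne: "axis (Inl undefined) 1 \<in> ?S"
    by simp
  have "continuous_on (K \<times> ?S) (\<lambda>z. norm (siegel (f (fst z)) *v snd z))"
    by (intro continuous_intros continuous_on_compose2[OF assms(2)])
      (use assms in auto)
  then have "continuous_on (K \<times> ?S) ?g"
    by (simp add: case_prod_unfold)
  moreover have "compact (K \<times> ?S)" "K \<times> ?S \<noteq> {}"
    using assms(1) False ne by (auto intro: compact_Times simp del: mem_sphere)
  ultimately obtain z where z: "z \<in> K \<times> ?S" and max: "\<And>w. w \<in> K \<times> ?S \<Longrightarrow> ?g w \<le> ?g z"
    using continuous_attains_sup by (metis (no_types, lifting))
  show ?thesis
  proof (rule that)
    show "0 \<le> ?g z"
      by (simp add: case_prod_unfold)
    have "norm (siegel (f (fst z)) *v snd z) < norm (snd z)"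
      using z assms(3) by (intro siegel_norm_less) auto
    then show "?g z < 1"
      using z by (auto simp: case_prod_unfold)
    show "siegel (f y) \<in> contractions (?g z)" if "y \<in> K" for y
      unfolding contractions_def
    proof (rule CollectI, rule allI)
      fix v :: "real^('n + 'n)"
      show "norm (siegel (f y) *v v) \<le> ?g z * norm v"
      proof (cases "v = 0")
        case False
        have "?g (y, v /\<^sub>R norm v) \<le> ?g z"
          using that False by (intro max) auto
        with False show ?thesis
          by (simp add: matrix_vector_mult_scaleR field_simps)
      qed simp
    qed
  qed
qed

text \<open>The last clause matters for paths with both ends in U(n): there the homotopy is
  constant, so its lift will not move the endpoints.\<close>

lemma polar_homotopy:
  fixes f :: "'b::metric_space \<Rightarrow> real^('n::finite + 'n)^('n + 'n)"
  assumes K: "compact K" "continuous_on K f" "f ` K \<subseteq> carrier Sp"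
  obtains h where "continuous_on ({0..1} \<times> K) h" "h ` ({0..1} \<times> K) \<subseteq> carrier Sp"
    "\<And>y. y \<in> K \<Longrightarrow> h (0::real, y) = mat 1"
    "\<And>y. y \<in> K \<Longrightarrow> h (1, y) ** f y \<in> unitary_part"
    "\<And>s y. y \<in> K \<Longrightarrow> f y \<in> unitary_part \<Longrightarrow> h (s, y) = mat 1"
proof -
  obtain r where r: "0 \<le> r" "r < 1" "\<And>y. y \<in> K \<Longrightarrow> siegel (f y) \<in> contractions r"
    using siegel_uniform_contraction[OF K] by metis
  let ?h = "\<lambda>z. polar_inverse (fst z) (siegel (f (snd z)))"
  show ?thesis
  proof (rule that[of ?h])
    show "continuous_on ({0..1} \<times> K) ?h"
      unfolding polar_inverse_def
      by (intro continuous_intros continuous_on_compose2[OF assms(2)]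
          continuous_on_compose2[OF isqrt_continuous_on[OF r(1,2)]])
        (use assms r contractions_square[OF r(3) r(1,2)] in auto)
    show "?h ` ({0..1} \<times> K) \<subseteq> carrier Sp"
      using K(3) by (auto intro!: polar_inverse_in_Sp[OF r(3) r(1,2)] siegel_symmetric siegel_anticommute)
    show "?h (1, y) ** f y \<in> unitary_part" if "y \<in> K" for y
      using polar_inverse_siegel[of "f y" r] that r K(3) by auto
  qed (auto simp: polar_inverse_def siegel_unitary)
qed

section \<open>The determinant of the complex linear part\<close>

definition symplectic_det :: "real^('n::finite + 'n)^('n + 'n) \<Rightarrow> complex" where
  "symplectic_det M = det (complex_matrix (clinear_part M))"

lemma continuous_on_symplectic_det [continuous_intros]:
  assumes "continuous_on S f"
  shows "continuous_on S (\<lambda>x. symplectic_det (f x))"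
  unfolding symplectic_det_def complex_matrix_def Complex_eq
  by (intro continuous_intros continuous_on_vec_lambda assms)

lemma complex_matrix_mult:
  assumes "M ** Omega = Omega ** M" "N ** Omega = Omega ** N"
  shows "complex_matrix (M ** N) = complex_matrix M ** complex_matrix N"
proof -
  have "M ** N = unitary_embedding (complex_matrix M ** complex_matrix N)"
    by (simp add: unitary_embedding_mult unitary_embedding_complex_matrix assms)
  then show ?thesis by simp
qed

text \<open>The real inverse of X also commutes with \<open>Omega\<close>, so it comes from a
  complex matrix inverse to that of X.\<close>

lemma symplectic_det_nonzero:
  assumes "M \<in> carrier Sp"
  shows "symplectic_det M \<noteq> 0"
proof -
  let ?X = "clinear_part M"
  note inv = matrix_inv_mult[OF invertible_clinear_part[OF assms]]
  have "matrix_inv ?X ** Omega = matrix_inv ?X ** (Omega ** ?X) ** matrix_inv ?X"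
    by (simp add: inv flip: matrix_mul_assoc)
  also have "\<dots> = Omega ** matrix_inv ?X"
    by (simp add: inv matrix_mul_assoc flip: clinear_part_commute)
  finally have "complex_matrix ?X ** complex_matrix (matrix_inv ?X) = complex_matrix (mat 1)"
    by (simp add: inv clinear_part_commute flip: complex_matrix_mult)
  also have "\<dots> = mat 1"
    by (metis complex_matrix_unitary_embedding unitary_embedding_1)
  finally have "det (complex_matrix ?X) * det (complex_matrix (matrix_inv ?X)) = 1"
    by (metis det_I det_mul)
  then show ?thesis
    by (auto simp: symplectic_det_def)
qed

lemma symplectic_det_unitary_embedding [simp]: "symplectic_det (unitary_embedding U) = det U"
  by (simp add: symplectic_det_def commute_Omega_parts unitary_embedding_commute)

lemma symplectic_det_mult:
  assumes "M \<in> unitary_part" "N \<in> unitary_part"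
  shows "symplectic_det (M ** N) = symplectic_det M * symplectic_det N"
  using assms by (auto simp: unitary_part_eq det_mul simp flip: unitary_embedding_mult)

lemma det_cnj: "det (\<chi> i j. cnj (A $ i $ j)) = cnj (det (A :: complex^'n^'n))"
  by (simp add: det_def)

lemma norm_symplectic_det:
  assumes "M \<in> unitary_part"
  shows "norm (symplectic_det M) = 1"
proof -
  obtain U where U: "adjoint_matrix U ** U = mat 1" "M = unitary_embedding U"
    using assms by (auto simp: unitary_part_eq unitary_matrices_def)
  have "adjoint_matrix U = transpose (\<chi> i j. cnj (U $ i $ j))"
    by (simp add: adjoint_matrix_def transpose_def)
  then have "det (adjoint_matrix U) = cnj (det U)"
    by (simp add: det_cnj)
  then have "cnj (det U) * det U = 1"
    using U(1) by (metis det_I det_mul)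
  then have "(norm (det U))\<^sup>2 = 1"
    by (metis complex_norm_square mult.commute of_real_1 of_real_eq_iff)
  then show ?thesis
    by (simp add: U(2) power2_eq_1_iff) (metis norm_ge_zero neg_0_le_iff_le not_one_le_zero)
qed

section \<open>Scalar rotations\<close>

lemma det_mat_power: "det (mat c :: 'a::comm_ring_1^'n^'n) = c ^ CARD('n)"
  by (subst det_diagonal) (auto simp: mat_def)

definition rotation :: "real \<Rightarrow> real^('n::finite + 'n)^('n + 'n)" where
  "rotation t = unitary_embedding (mat (exp (\<i> * complex_of_real t)))"

lemma mat_mult_mat: "(mat a :: 'a::comm_ring_1^'n^'n) ** mat b = mat (a * b)"
  by (simp add: vec_eq_iff matrix_matrix_mult_def mat_def mult_delta_left)

lemma rotation_add: "rotation (s + t) = rotation s ** rotation t"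
  by (simp add: rotation_def distrib_left exp_add mat_mult_mat flip: unitary_embedding_mult)

lemma rotation_0 [simp]: "rotation 0 = mat 1"
  by (simp add: rotation_def)

lemma continuous_on_rotation [continuous_intros]:
  fixes f :: "'a::topological_space \<Rightarrow> real"
  assumes "continuous_on S f"
  shows "continuous_on S (\<lambda>x. rotation (f x) :: real^('n::finite + 'n)^('n + 'n))"
proof -
  have *: "continuous_on S (\<lambda>x. block (A x) (B x) (C x) (D x) $ i $ j)"
    if "continuous_on S A" "continuous_on S B" "continuous_on S C" "continuous_on S D"
    for A B C D :: "'a \<Rightarrow> real^'n^'n" and i j
    by (cases i; cases j) (auto intro!: continuous_intros that)
  have m: "continuous_on S (\<lambda>x. mat (g x) :: real^'n^'n)" if "continuous_on S g" for g
  proof -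
    have "continuous_on S (\<lambda>x. if i = j then g x else 0)" for i j :: 'n
      by (cases "i = j") (auto intro: that)
    then show ?thesis
      unfolding mat_def by (intro continuous_on_vec_lambda)
  qed
  have "continuous_on S (\<lambda>x. \<chi> i j. (rotation (f x) :: real^('n + 'n)^('n + 'n)) $ i $ j)"
    unfolding rotation_def unitary_embedding_mat
    by (intro continuous_on_vec_lambda, rule *) (intro m continuous_intros assms)+
  then show ?thesis by simp
qed

lemma scalar_unitary: "(mat (exp (\<i> * complex_of_real t)) :: complex^'n^'n) \<in> unitary_matrices"
proof -
  have "adjoint_matrix (mat (exp (\<i> * complex_of_real t)) :: complex^'n^'n) =
      mat (exp (- (\<i> * complex_of_real t)))"
    by (auto simp: adjoint_matrix_def mat_def vec_eq_iff exp_cnj)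
  then show ?thesis
    by (simp add: unitary_matrices_def mat_mult_mat mult_exp_exp)
qed

lemma rotation_unitary: "rotation t \<in> unitary_part"
  unfolding rotation_def unitary_part_eq using scalar_unitary by blast

lemma symplectic_det_rotation:
  "symplectic_det (rotation t :: real^('n::finite + 'n)^('n + 'n)) =
   exp (\<i> * complex_of_real (real CARD('n) * t))"
  by (simp add: rotation_def det_mat_power exp_of_nat_mult[symmetric] mult.left_commute)

lemma scalar_unitary_image: "unitary_embedding ` scalar_unitary_matrices = range rotation"
  by (auto simp: rotation_def scalar_unitary_matrices_def)

lemma special_unitary_image:
  "unitary_embedding ` special_unitary_matrices = {M \<in> unitary_part. symplectic_det M = 1}"
  by (auto simp: unitary_part_eq special_unitary_matrices_def)

section \<open>A deformation inside U(n) near the identity\<close>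

text \<open>The unitary polar factor of the point \<open>(1 - s) + sM\<close> of the segment from \<open>1\<close> to a unitary \<open>M\<close>.\<close>

definition unitary_path :: "real \<Rightarrow> real^('n::finite + 'n)^('n + 'n) \<Rightarrow> real^('n + 'n)^('n + 'n)" where
  "unitary_path s M = ((1 - s) *\<^sub>R mat 1 + s *\<^sub>R M) **
     isqrt ((s * (1 - s)) *\<^sub>R (2 *\<^sub>R mat 1 - M - transpose M))"

lemma unitary_path_ends [simp]:
  "unitary_path 0 M = mat 1" "unitary_path 1 M = M" "unitary_path s (mat 1) = mat 1"
  by (simp_all add: unitary_path_def scaleR_2 flip: scaleR_add_left)

lemma contractions_scale:
  assumes "Z \<in> contractions r" "0 \<le> r" "0 \<le> c" "c \<le> 1"
  shows "c *\<^sub>R Z \<in> contractions r"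
  unfolding contractions_def
proof (rule CollectI, rule allI)
  fix v
  have "c * norm (Z *v v) \<le> 1 * (r * norm v)"
    using assms by (intro mult_mono) (auto simp: contractions_def)
  then show "norm ((c *\<^sub>R Z) *v v) \<le> r * norm v"
    using assms by (simp flip: scaleR_matrix_vector_assoc)
qed

lemma interval_product_bounds:
  assumes "s \<in> {0..1::real}"
  shows "0 \<le> s * (1 - s)" "s * (1 - s) \<le> 1"
  using assms mult_le_one[of s "1 - s"] by auto

lemma unitary_path_in_unitary_part:
  assumes M: "M \<in> unitary_part" and s: "s \<in> {0..1}"
    and Z: "2 *\<^sub>R mat 1 - M - transpose M \<in> contractions (1/2)"
  shows "unitary_path s M \<in> unitary_part"
proof -
  let ?Z = "(s * (1 - s)) *\<^sub>R (2 *\<^sub>R mat 1 - M - transpose M)"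
  let ?X = "(1 - s) *\<^sub>R mat 1 + s *\<^sub>R M"
  let ?D = "isqrt ?Z"
  have c: "M ** Omega = Omega ** M" "transpose M ** M = mat 1"
    using M commute_Omega_symplectic by (auto simp: unitary_part_def)
  note ct = commute_Omega_transpose[OF c(1)]
  have Z': "?Z \<in> contractions (1/2)"
    using interval_product_bounds[OF s] Z by (intro contractions_scale) auto
  have "Omega ** ?Z = ?Z ** Omega"
    by (simp add: mat_algebra c ct)
  then have DO: "Omega ** ?D = ?D ** Omega"
    using isqrt_commute[OF Z'] by simp
  have Dt: "transpose ?D = ?D"
    by (rule isqrt_transpose) (simp add: transpose_linear vec_eq_iff)
  \<comment> \<open>This computes how far the point of the segment is from orthogonal, and is the
    origin of the argument of \<open>isqrt\<close> in \<open>unitary_path\<close>. The defect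
    carries the factor s (1 - s), so both endpoints stay put.\<close>
  have "transpose ?X ** ?X = ((1 - s) * (1 - s)) *\<^sub>R mat 1 + (s * (1 - s)) *\<^sub>R M +
      (s * (1 - s)) *\<^sub>R transpose M + (s * s) *\<^sub>R mat 1"
    by (simp add: transpose_linear mat_algebra c) (simp add: vec_eq_iff algebra_simps)
  also have "\<dots> = mat 1 - ?Z"
    by (simp add: vec_eq_iff algebra_simps)
  finally have X: "transpose ?X ** ?X = mat 1 - ?Z" .
  have "(mat 1 - ?Z) ** ?Z = ?Z ** (mat 1 - ?Z)"
    by (simp only: mat_mult_diff_left mat_mult_diff_right matrix_mul_lid matrix_mul_rid)
  then have DZ: "(mat 1 - ?Z) ** ?D = ?D ** (mat 1 - ?Z)"
    using isqrt_commute[OF Z'] by simp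
  have XO: "?X ** Omega = Omega ** ?X"
    by (simp add: mat_algebra c)
  have "?X ** ?D ** Omega = (?X ** Omega) ** ?D"
    by (simp add: DO flip: matrix_mul_assoc)
  also have "\<dots> = Omega ** (?X ** ?D)"
    by (simp only: XO matrix_mul_assoc)
  finally have O: "?X ** ?D ** Omega = Omega ** (?X ** ?D)" .
  have "transpose (?X ** ?D) ** (?X ** ?D) = ?D ** (transpose ?X ** ?X) ** ?D"
    by (simp only: matrix_transpose_mul Dt matrix_mul_assoc)
  also have "\<dots> = (mat 1 - ?Z) ** (?D ** ?D)"
    unfolding X by (simp only: DZ[symmetric] matrix_mul_assoc)
  also have "\<dots> = mat 1"
    by (rule isqrt_square_inverse[OF Z']) auto
  finally show ?thesis
    using O commute_Omega_symplectic[OF O] by (simp add: unitary_part_def unitary_path_def)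
qed

lemma continuous_on_unitary_path:
  "continuous_on ({0..1} \<times> {M. 2 *\<^sub>R mat 1 - M - transpose M \<in> contractions (1/2)})
     (\<lambda>z. unitary_path (fst z) (snd z))"
  unfolding unitary_path_def
  by (intro continuous_intros continuous_on_compose2[OF isqrt_continuous_on[of "1/2"]])
    (auto intro!: contractions_scale interval_product_bounds)

lemma contractions_near_1:
  obtains d where "0 < d"
    "\<And>M :: real^('n::finite + 'n)^('n + 'n). dist M (mat 1) \<le> d \<Longrightarrow>
       2 *\<^sub>R mat 1 - M - transpose M \<in> contractions (1/2)"
proof -
  obtain B where B: "0 < B"
    "\<And>(A :: real^('n + 'n)^('n + 'n)) v. norm (A *v v) \<le> norm A * norm v * B"
    using bounded_bilinear.pos_bounded[OF bounded_bilinear_matrix_vector_mult] by blast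
  let ?Z = "\<lambda>M :: real^('n + 'n)^('n + 'n). 2 *\<^sub>R mat 1 - M - transpose M"
  have "continuous_on UNIV ?Z"
    by (intro continuous_intros)
  then have "isCont ?Z (mat 1)"
    by (simp add: continuous_on_eq_continuous_at)
  moreover have "?Z (mat 1) = 0"
    by (simp add: scaleR_2)
  ultimately obtain d where d: "0 < d" "\<And>M. dist M (mat 1) < d \<Longrightarrow> norm (?Z M) < 1 / (2 * B)"
    using B(1) unfolding continuous_at_eps_delta
    by (metis (no_types, lifting) diff_zero dist_norm divide_pos_pos mult_pos_pos zero_less_numeral zero_less_one)
  show ?thesis
  proof (rule that)
    \<comment> \<open>Halving \<open>d\<close> leaves room for a closed ball, whose compactness
      gives uniform continuity of \<open>unitary_path\<close> later.\<close>
    show "0 < d / 2" using d by simp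
    fix M :: "real^('n + 'n)^('n + 'n)" assume "dist M (mat 1) \<le> d / 2"
    then have "norm (?Z M) < 1 / (2 * B)"
      using d by auto
    then have "norm (?Z M) * B \<le> 1/2"
      using B(1) by (simp add: field_simps)
    then have "norm (?Z M *v v) \<le> 1/2 * norm v" for v
      using B(2)[of "?Z M" v] mult_right_mono[of "norm (?Z M) * B" "1/2" "norm v"]
      by (simp add: mult.assoc mult.left_commute mult.commute)
    then show "?Z M \<in> contractions (1/2)"
      by (simp add: contractions_def)
  qed
qed

text \<open>Commuting with \<open>Omega\<close> leaves the blocks A, B, -B, A. Shears by symmetric S
  then force B = 0 and A S = S A. The matrix units on the diagonal make A diagonal, the all-ones
  matrix makes its diagonal constant, and the symplectic relation leaves only the scalars 1 and
  -1.\<close>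

lemma Sp_central_imp_scalar:
  fixes Z :: "real^('n::finite + 'n)^('n + 'n)"
  assumes Z: "Z \<in> carrier Sp" and central: "\<And>M. M \<in> carrier Sp \<Longrightarrow> Z ** M = M ** Z"
  shows "Z = mat 1 \<or> Z = - mat 1"
proof -
  define shear where "shear S = block (mat 1) S 0 (mat 1 :: real^'n^'n)" for S
  have shear: "shear S \<in> carrier Sp" if "transpose S = S" for S
    by (simp add: shear_def Sp_carrier_iff Omega_def transpose_block block_mult that mat_algebra)
  have "Omega \<in> carrier Sp"
    by (simp add: Sp_carrier_iff transpose_Omega Omega_mult_Omega mat_algebra)
  then have "Z ** Omega = Omega ** Z"
    by (rule central)
  then obtain A B where AB: "Z = block A B (- B) A"
    by (cases Z rule: block_cases) (auto simp: commute_Omega_iff)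
  have S: "A ** S + B = B + S ** A" "A = A - S ** B" if "transpose S = S" for S
    using central[OF shear[OF that]] by (auto simp: AB shear_def block_mult block_eq_iff mat_algebra)
  have "B = 0"
    using S(2)[of "mat 1"] by simp
  have AS: "A ** S = S ** A" if "transpose S = S" for S
    using S(1)[OF that] by simp
  have offdiag: "A $ k $ i = 0" if "k \<noteq> i" for k i
  proof -
    let ?E = "\<chi> k l. if k = i \<and> l = i then 1 else (0 :: real)"
    have "transpose ?E = ?E"
      by (auto simp: transpose_def vec_eq_iff)
    then have "(A ** ?E) $ k $ i = (?E ** A) $ k $ i"
      by (simp add: AS)
    with that show ?thesis
      by (simp add: matrix_matrix_mult_def if_distrib cong: if_cong)
  qed
  have diag: "A $ k $ k = A $ l $ l" for k l
  proof -
    let ?J = "(\<chi> k l. 1) :: real^'n^'n"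
    have "transpose ?J = ?J"
      by (auto simp: transpose_def vec_eq_iff)
    then have "(A ** ?J) $ k $ l = (?J ** A) $ k $ l"
      by (simp add: AS)
    then have "(\<Sum>m\<in>UNIV. A $ k $ m) = (\<Sum>m\<in>UNIV. A $ m $ l)"
      by (simp add: matrix_matrix_mult_def)
    moreover have "(\<Sum>m\<in>UNIV. A $ k $ m) = (\<Sum>m\<in>{k}. A $ k $ m)"
      "(\<Sum>m\<in>UNIV. A $ m $ l) = (\<Sum>m\<in>{l}. A $ m $ l)"
      by (intro sum.mono_neutral_right; auto intro: offdiag)+
    ultimately show ?thesis by simp
  qed
  define a where "a = A $ undefined $ undefined"
  have "A = mat a"
    using offdiag diag by (auto simp: vec_eq_iff mat_def a_def)
  then have Za: "Z = a *\<^sub>R mat 1"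
    using AB \<open>B = 0\<close> by (auto simp: vec_eq_iff_Plus mat_def)
  then have "(a * a) *\<^sub>R Omega = (Omega :: real^('n + 'n)^('n + 'n))"
    using Z by (simp add: Sp_carrier_iff transpose_linear mat_algebra)
  then have "((a * a) *\<^sub>R Omega) $ Inl (undefined::'n) $ Inr (undefined::'n) =
      (Omega :: real^('n + 'n)^('n + 'n)) $ Inl undefined $ Inr undefined"
    by simp
  then have "a * a = 1"
    by (simp add: Omega_def mat_def)
  then have "a = 1 \<or> a = -1"
    by (simp add: square_eq_1_iff)
  then show ?thesis
    using Za by auto
qed

lemma uminus_mat_1_unitary: "- mat 1 \<in> unitary_part" and mat_1_unitary: "mat 1 \<in> unitary_part"
  by (auto simp: unitary_part_def Sp_one_closed uminus_Sp_closed mat_algebra)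


section \<open>Lifting in covering groups\<close>

text \<open>Uniform continuity is used in the base only, so a metric is assumed there, while the
  total space carries just a topology.\<close>

locale covering_group =
  fixes G :: "('g::topological_space, 'm) monoid_scheme" (structure)
    and K :: "('k::metric_space, 'l) monoid_scheme"
    and p :: "'g \<Rightarrow> 'k"
  assumes topological_G: "topological_group G"
    and topological_K: "topological_group K"
    and p_hom: "p \<in> hom G K"
    and covering: "covering_space (carrier G) p (carrier K)"

sublocale covering_group \<subseteq> G: group G
  using topological_G by (simp add: topological_group_def)

sublocale covering_group \<subseteq> K: group K
  using topological_K by (simp add: topological_group_def)

context covering_group
begin

lemma continuous_on_G_mult:
  assumes "continuous_on S f" "continuous_on S g" "f ` S \<subseteq> carrier G" "g ` S \<subseteq> carrier G"
  shows "continuous_on S (\<lambda>x. f x \<otimes> g x)"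
proof -
  have "continuous_on (carrier G \<times> carrier G) (\<lambda>z. fst z \<otimes> snd z)"
    using topological_G by (simp add: topological_group_def case_prod_unfold)
  then have "continuous_on S (\<lambda>x. fst (f x, g x) \<otimes> snd (f x, g x))"
    by (rule continuous_on_compose2) (use assms in \<open>auto intro!: continuous_intros\<close>)
  then show ?thesis by simp
qed

lemma continuous_on_K_mult:
  assumes "continuous_on S f" "continuous_on S g" "f ` S \<subseteq> carrier K" "g ` S \<subseteq> carrier K"
  shows "continuous_on S (\<lambda>x. f x \<otimes>\<^bsub>K\<^esub> g x)"
proof -
  have "continuous_on (carrier K \<times> carrier K) (\<lambda>z. fst z \<otimes>\<^bsub>K\<^esub> snd z)"
    using topological_K by (simp add: topological_group_def case_prod_unfold)
  then have "continuous_on S (\<lambda>x. fst (f x, g x) \<otimes>\<^bsub>K\<^esub> snd (f x, g x))"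
    by (rule continuous_on_compose2) (use assms in \<open>auto intro!: continuous_intros\<close>)
  then show ?thesis by simp
qed

lemma continuous_on_G_inv:
  assumes "continuous_on S f" "f ` S \<subseteq> carrier G"
  shows "continuous_on S (\<lambda>x. inv (f x))"
  using topological_G assms by (auto simp: topological_group_def intro: continuous_on_compose2)

lemma continuous_on_K_inv:
  assumes "continuous_on S f" "f ` S \<subseteq> carrier K"
  shows "continuous_on S (\<lambda>x. inv\<^bsub>K\<^esub> (f x))"
  using topological_K assms by (auto simp: topological_group_def intro: continuous_on_compose2)

lemma continuous_on_p:
  assumes "continuous_on S f" "f ` S \<subseteq> carrier G"
  shows "continuous_on S (\<lambda>x. p (f x))"
  using covering_space_imp_continuous[OF covering] assms by (auto intro: continuous_on_compose2)

sublocale p: group_hom G K p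
  by (simp add: group_hom_def group_hom_axioms_def p_hom G.group_axioms K.group_axioms)

lemma p_surj: "p ` carrier G = carrier K"
  by (rule covering_space_imp_surjective[OF covering])

lemma local_section:
  obtains U T q where "\<one> \<in> U" "openin (top_of_set (carrier G)) U"
    "\<one>\<^bsub>K\<^esub> \<in> T" "openin (top_of_set (carrier K)) T"
    "continuous_on T q" "q ` T \<subseteq> U" "\<And>x. x \<in> U \<Longrightarrow> p x \<in> T" "\<And>x. x \<in> U \<Longrightarrow> q (p x) = x"
    "\<And>y. y \<in> T \<Longrightarrow> p (q y) = y"
proof -
  obtain U T q where "\<one> \<in> U" "openin (top_of_set (carrier G)) U"
    "p \<one> \<in> T" "openin (top_of_set (carrier K)) T" "homeomorphism U T p q"
    using covering_space_local_homeomorphism[OF covering G.one_closed] by metis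
  then show ?thesis
    using that[of U T q] by (auto simp: homeomorphism_def)
qed

text \<open>The kernel is discrete: within \<open>U\<close> the section recovers a point from its
  image, so the identity is the only kernel element there. By translation, the level sets of
  \<open>d\<close> are open, and connectedness leaves just one.\<close>

lemma kernel_valued_constant:
  assumes S: "connected S" "continuous_on S d" "d ` S \<subseteq> carrier G"
    and d: "\<And>x. x \<in> S \<Longrightarrow> p (d x) = \<one>\<^bsub>K\<^esub>" and a: "a \<in> S" "b \<in> S"
  shows "d a = d b"
proof -
  obtain U T q where U: "\<one> \<in> U" "openin (top_of_set (carrier G)) U"
    "\<And>x. x \<in> U \<Longrightarrow> q (p x) = x"
    using local_section by metis
  have opn: "openin (top_of_set S) {x \<in> S. d x = d a}" if "a \<in> S" for a
  proof -
    have "d x = d a" if x: "x \<in> S" "d x \<otimes> inv (d a) \<in> U" for x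
    proof -
      have "p (d x \<otimes> inv (d a)) = p \<one>"
        using x \<open>a \<in> S\<close> S(3) d by (auto simp: image_subset_iff)
      then have "d x \<otimes> inv (d a) = \<one>"
        using U x(2) by metis
      moreover have "d x \<in> carrier G" "d a \<in> carrier G"
        using x \<open>a \<in> S\<close> S(3) by auto
      ultimately show ?thesis
        by (metis G.inv_closed G.inv_equality G.inv_inv)
    qed
    then have "{x \<in> S. d x = d a} = S \<inter> (\<lambda>x. d x \<otimes> inv (d a)) -` U"
      using S(3) \<open>a \<in> S\<close> U(1) by (auto simp: image_subset_iff)
    moreover have "openin (top_of_set S) (S \<inter> (\<lambda>x. d x \<otimes> inv (d a)) -` U)"
      using S(3) \<open>a \<in> S\<close>
      by (intro continuous_openin_preimage[OF _ _ U(2)] continuous_on_G_mult S continuous_on_const)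
        (auto simp: image_subset_iff)
    ultimately show ?thesis by simp
  qed
  have "S - {x \<in> S. d x = d a} = (\<Union>b \<in> {b \<in> S. d b \<noteq> d a}. {x \<in> S. d x = d b})"
    by auto
  moreover have "openin (top_of_set S) (\<Union>b \<in> {b \<in> S. d b \<noteq> d a}. {x \<in> S. d x = d b})"
    using opn by (intro openin_Union) auto
  ultimately have "closedin (top_of_set S) {x \<in> S. d x = d a}"
    by (simp add: closedin_def)
  with S(1) opn[OF a(1)] have "{x \<in> S. d x = d a} = {} \<or> {x \<in> S. d x = d a} = S"
    by (auto simp: connected_clopen)
  moreover have "a \<in> {x \<in> S. d x = d a}"
    using a by simp
  ultimately have "{x \<in> S. d x = d a} = S"
    by blast
  with a(2) have "b \<in> {x \<in> S. d x = d a}"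
    by blast
  then show ?thesis by simp
qed

text \<open>The quotient of the two lifts takes values in the kernel and is the identity at
  \<open>a\<close>.\<close>

lemma unique_lift:
  assumes "connected S" "continuous_on S f" "f ` S \<subseteq> carrier G" "continuous_on S g" "g ` S \<subseteq> carrier G"
    and "\<And>x. x \<in> S \<Longrightarrow> p (f x) = p (g x)" and "a \<in> S" "f a = g a" "x \<in> S"
  shows "f x = g x"
proof -
  have G: "f y \<in> carrier G" "g y \<in> carrier G" if "y \<in> S" for y
    using assms that by auto
  have "f x \<otimes> inv (g x) = f a \<otimes> inv (g a)"
  proof (rule kernel_valued_constant[of S "\<lambda>x. f x \<otimes> inv (g x)"])
    show "continuous_on S (\<lambda>x. f x \<otimes> inv (g x))"
      using assms G by (intro continuous_on_G_mult continuous_on_G_inv) auto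
    show "p (f x \<otimes> inv (g x)) = \<one>\<^bsub>K\<^esub>" if "x \<in> S" for x
      using assms(6)[OF that] G[OF that] by simp
  qed (use assms G in auto)
  then have "f x \<otimes> inv (g x) = \<one>"
    using assms G by simp
  then show ?thesis
    using G[OF \<open>x \<in> S\<close>] by (metis G.inv_closed G.inv_equality G.inv_inv)
qed

text \<open>After subdividing the parameter interval into \<open>N\<close> parts, consecutive values of the homotopy
  differ by elements of the domain of a local section at the identity.\<close>

lemma lift_homotopy_from_one:
  fixes f :: "real \<times> 'b::metric_space \<Rightarrow> 'k"
  assumes C: "compact C" and f: "continuous_on ({0..1} \<times> C) f" "f ` ({0..1} \<times> C) \<subseteq> carrier K"
    and f0: "\<And>y. y \<in> C \<Longrightarrow> f (0, y) = \<one>\<^bsub>K\<^esub>"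
  obtains F where "continuous_on ({0..1} \<times> C) F" "F ` ({0..1} \<times> C) \<subseteq> carrier G"
    "\<And>s y. s \<in> {0..1} \<Longrightarrow> y \<in> C \<Longrightarrow> p (F (s, y)) = f (s, y)"
    "\<And>y. y \<in> C \<Longrightarrow> (\<And>s. s \<in> {0..1} \<Longrightarrow> f (s, y) = \<one>\<^bsub>K\<^esub>) \<Longrightarrow> F (1, y) = \<one>"
proof -
  obtain U T q where U: "\<one> \<in> U" "openin (top_of_set (carrier G)) U"
    and T: "\<one>\<^bsub>K\<^esub> \<in> T" "openin (top_of_set (carrier K)) T"
    and q: "continuous_on T q" "q ` T \<subseteq> U" "\<And>x. x \<in> U \<Longrightarrow> q (p x) = x" "\<And>y. y \<in> T \<Longrightarrow> p (q y) = y"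
    using local_section by metis
  have q1: "q \<one>\<^bsub>K\<^esub> = \<one>"
    using q(3)[OF U(1)] by simp
  have UG: "U \<subseteq> carrier G"
    using openin_imp_subset[OF U(2)] .
  have fK: "f (s, y) \<in> carrier K" if "s \<in> {0..1}" "y \<in> C" for s y
    using f(2) that by auto
  obtain e where e: "0 < e" "\<And>x. x \<in> carrier K \<Longrightarrow> dist x \<one>\<^bsub>K\<^esub> < e \<Longrightarrow> x \<in> T"
    using T unfolding openin_euclidean_subtopology_iff by metis
  \<comment> \<open>The increment of the homotopy between two times. It is the identity at equal
    times, so uniform continuity keeps it in \<open>T\<close> for times closer than
    \<open>d\<close>.\<close>
  define \<Phi> where "\<Phi> = (\<lambda>z. inv\<^bsub>K\<^esub> (f (fst (fst z), snd z)) \<otimes>\<^bsub>K\<^esub> f (snd (fst z), snd z))"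
  have "continuous_on (({0..1} \<times> {0..1}) \<times> C) \<Phi>"
    unfolding \<Phi>_def
    by (intro continuous_on_K_mult continuous_on_K_inv continuous_on_compose2[OF f(1)] continuous_intros)
      (use fK in auto)
  then have "uniformly_continuous_on (({0..1} \<times> {0..1}) \<times> C) \<Phi>"
    using C by (intro compact_uniformly_continuous compact_Times) auto
  then obtain d where d: "0 < d"
    "\<And>z w. z \<in> ({0..1} \<times> {0..1}) \<times> C \<Longrightarrow> w \<in> ({0..1} \<times> {0..1}) \<times> C \<Longrightarrow> dist w z < d \<Longrightarrow>
       dist (\<Phi> w) (\<Phi> z) < e"
    unfolding uniformly_continuous_on_def using e(1) by metis
  have small: "\<Phi> ((s, t), y) \<in> T" if "s \<in> {0..1}" "t \<in> {0..1}" "y \<in> C" "\<bar>t - s\<bar> < d" for s t y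
  proof (rule e(2))
    show "\<Phi> ((s, t), y) \<in> carrier K"
      using fK that by (simp add: \<Phi>_def)
    have "\<Phi> ((s, s), y) = \<one>\<^bsub>K\<^esub>"
      using fK that by (simp add: \<Phi>_def)
    moreover have "dist ((s, t), y) ((s, s), y) < d"
      using that by (simp add: dist_Pair_Pair dist_real_def)
    ultimately show "dist (\<Phi> ((s, t), y)) \<one>\<^bsub>K\<^esub> < e"
      using d(2)[of "((s, s), y)" "((s, t), y)"] that by auto
  qed
  obtain N :: nat where N: "0 < N" "1 / N < d"
    using d(1) by (metis nat_approx_posE zero_less_Suc)
  \<comment> \<open>The homotopy is stopped at time j / N: for \<open>s\<close> in the unit interval
    the stopped time is 0 for j = 0 and \<open>s\<close> for j = N. Passing from j to j + 1
    multiplies the lift by the image of one small increment under \<open>q\<close>.\<close>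
  define m where "m j s = min s (real j / N)" for j s
  have m: "m j s \<in> {0..1}" "\<bar>m (Suc j) s - m j s\<bar> < d" if "s \<in> {0..1}" for j s
  proof -
    show "m j s \<in> {0..1}"
      using that by (auto simp: m_def)
    have "\<bar>min s (x + e) - min s x\<bar> \<le> e" if "0 < e" for x e :: real
      using that by (auto simp: min_def)
    from this[of "1 / N" "real j / N"] have "\<bar>m (Suc j) s - m j s\<bar> \<le> 1 / N"
      using N(1) by (simp add: m_def add_divide_distrib add.commute)
    with N(2) show "\<bar>m (Suc j) s - m j s\<bar> < d"
      by linarith
  qed
  have cm: "continuous_on ({0..1} \<times> C) (\<lambda>z. m j (fst z))" for j
    unfolding m_def by (intro continuous_intros)
  have "\<exists>F. continuous_on ({0..1} \<times> C) F \<and> F ` ({0..1} \<times> C) \<subseteq> carrier G \<and>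
      (\<forall>s\<in>{0..1}. \<forall>y\<in>C. p (F (s, y)) = f (m j s, y)) \<and>
      (\<forall>y\<in>C. (\<forall>s\<in>{0..1}. f (s, y) = \<one>\<^bsub>K\<^esub>) \<longrightarrow> F (1, y) = \<one>)" for j
  proof (induction j)
    case 0
    show ?case
      by (rule exI[of _ "\<lambda>_. \<one>"]) (auto simp: m_def f0)
  next
    case (Suc j)
    then obtain F where F: "continuous_on ({0..1} \<times> C) F" "F ` ({0..1} \<times> C) \<subseteq> carrier G"
      "\<And>s y. s \<in> {0..1} \<Longrightarrow> y \<in> C \<Longrightarrow> p (F (s, y)) = f (m j s, y)"
      "\<And>y. y \<in> C \<Longrightarrow> (\<forall>s\<in>{0..1}. f (s, y) = \<one>\<^bsub>K\<^esub>) \<Longrightarrow> F (1, y) = \<one>"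
      by metis
    define \<Psi> where "\<Psi> = (\<lambda>z. \<Phi> ((m j (fst z), m (Suc j) (fst z)), snd z))"
    have \<Psi>T: "\<Psi> ` ({0..1} \<times> C) \<subseteq> T"
      using small m by (auto simp: \<Psi>_def)
    have "continuous_on ({0..1} \<times> C) \<Psi>"
      unfolding \<Psi>_def
      by (intro continuous_on_compose2[OF \<open>continuous_on _ \<Phi>\<close>] continuous_intros cm) (use m in auto)
    then have "continuous_on ({0..1} \<times> C) (\<lambda>z. q (\<Psi> z))"
      by (rule continuous_on_compose2[OF q(1)]) (use \<Psi>T in auto)
    moreover have qG: "q (\<Psi> z) \<in> carrier G" if "z \<in> {0..1} \<times> C" for z
      using that \<Psi>T q(2) UG by blast
    ultimately have "continuous_on ({0..1} \<times> C) (\<lambda>z. F z \<otimes> q (\<Psi> z))"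
      using F by (intro continuous_on_G_mult) auto
    moreover have "p (F (s, y) \<otimes> q (\<Psi> (s, y))) = f (m (Suc j) s, y)" if "s \<in> {0..1}" "y \<in> C" for s y
    proof -
      have "F (s, y) \<in> carrier G" "\<Psi> (s, y) \<in> T" using F(2) \<Psi>T that by auto
      then have "p (F (s, y) \<otimes> q (\<Psi> (s, y))) = p (F (s, y)) \<otimes>\<^bsub>K\<^esub> \<Psi> (s, y)"
        using qG[of "(s, y)"] q(4)[of "\<Psi> (s, y)"] that by auto
      then show ?thesis
        using F(3)[OF that] fK m that by (simp add: \<Psi>_def \<Phi>_def flip: K.m_assoc)
    qed
    \<comment> \<open>Where the homotopy is constant, every increment is the identity, and
      \<open>q\<close> sends the identity to the identity.\<close>
    moreover have "F (1, y) \<otimes> q (\<Psi> (1, y)) = \<one>"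
      if "y \<in> C" "\<forall>s\<in>{0..1}. f (s, y) = \<one>\<^bsub>K\<^esub>" for y
    proof -
      have "m j 1 \<in> {0..1}" "m (Suc j) 1 \<in> {0..1}"
        by (rule m; simp)+
      then have "f (m j 1, y) = \<one>\<^bsub>K\<^esub>" "f (m (Suc j) 1, y) = \<one>\<^bsub>K\<^esub>"
        using that by blast+
      with F(4)[OF that] show ?thesis
        by (simp add: \<Psi>_def \<Phi>_def q1)
    qed
    ultimately show ?case
      using F(2) qG by (intro exI[of _ "\<lambda>z. F z \<otimes> q (\<Psi> z)"]) (auto simp: image_subset_iff)
  qed
  from this[of N] obtain F where F: "continuous_on ({0..1} \<times> C) F" "F ` ({0..1} \<times> C) \<subseteq> carrier G"
      "\<And>s y. s \<in> {0..1} \<Longrightarrow> y \<in> C \<Longrightarrow> p (F (s, y)) = f (m N s, y)"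
      "\<And>y. y \<in> C \<Longrightarrow> (\<forall>s\<in>{0..1}. f (s, y) = \<one>\<^bsub>K\<^esub>) \<Longrightarrow> F (1, y) = \<one>"
    by metis
  have "m N s = s" if "s \<in> {0..1}" for s
    using that N by (auto simp: m_def)
  with F that show ?thesis by auto
qed

end


section \<open>The universal cover of the symplectic group\<close>

lemma topological_group_Sp: "topological_group (Sp :: (real^('n::finite + 'n)^('n + 'n)) monoid)"
  unfolding topological_group_def
proof (intro conjI Sp_group)
  show "continuous_on (carrier Sp \<times> carrier Sp)
      (\<lambda>(x, y). x \<otimes>\<^bsub>Sp\<^esub> y :: real^('n + 'n)^('n + 'n))"
    by (simp add: case_prod_unfold) (intro continuous_intros)
  have "continuous_on (carrier Sp) (Sp_inverse :: _ \<Rightarrow> real^('n + 'n)^('n + 'n))"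
    by (intro continuous_intros)
  then show "continuous_on (carrier Sp) (\<lambda>x. inv\<^bsub>Sp\<^esub> x :: real^('n + 'n)^('n + 'n))"
    by (rule continuous_on_eq) (simp add: Sp_inv_eq)
qed

locale symplectic_cover =
  fixes G :: "('g::topological_space, 'm) monoid_scheme" (structure)
    and p :: "'g \<Rightarrow> real^('n::finite + 'n)^('n + 'n)"
  assumes universal: "universal_covering_group G p Sp"

sublocale symplectic_cover \<subseteq> covering_group G Sp p
  using universal topological_group_Sp
  by (simp add: covering_group_def universal_covering_group_def)

context symplectic_cover
begin

lemma p_in_Sp: "x \<in> carrier G \<Longrightarrow> p x \<in> carrier Sp"
  by (rule p.hom_closed)

lemma p_mult: "x \<in> carrier G \<Longrightarrow> y \<in> carrier G \<Longrightarrow> p (x \<otimes> y) = p x ** p y"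
  by simp

lemma simply_connected_G: "simply_connected (carrier G)"
  using universal by (simp add: universal_covering_group_def)

text \<open>\<open>simply_connected\<close> provides free homotopies between any two loops, so the
  target may be the constant loop at any chosen point.\<close>

lemma null_homotopic_loop:
  assumes "continuous_on {0..1} c" "c ` {0..1} \<subseteq> carrier G" "c 0 = c 1" "g \<in> carrier G"
  obtains h where "continuous_on ({0..1::real} \<times> {0..1::real}) h" "h ` ({0..1} \<times> {0..1}) \<subseteq> carrier G"
    "\<And>x. x \<in> {0..1} \<Longrightarrow> h (0, x) = c x" "\<And>x. x \<in> {0..1} \<Longrightarrow> h (1, x) = g"
    "\<And>s. s \<in> {0..1} \<Longrightarrow> h (s, 0) = h (s, 1)"
proof -
  have "homotopic_loops (carrier G) c (\<lambda>_. g)"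
    by (rule simply_connected_G[unfolded simply_connected_def path_def path_image_def
          pathstart_def pathfinish_def, rule_format]) (use assms in auto)
  then obtain h where "continuous_on ({0..1::real} \<times> {0..1::real}) h"
    "h \<in> ({0..1} \<times> {0..1}) \<rightarrow> carrier G"
    "\<forall>x\<in>{0..1}. h (0, x) = c x" "\<forall>x\<in>{0..1}. h (1, x) = g"
    "\<forall>s\<in>{0..1}. h (s, 1) = h (s, 0)"
    unfolding homotopic_loops pathstart_def pathfinish_def by auto
  then show ?thesis
    by (intro that[of h]) (simp_all add: image_subset_iff_funcset)
qed

text \<open>A free homotopy between the constant loops at the identity and at \<open>g\<close>,
  followed at a single parameter, is a path between these points.\<close>

lemma path_from_one:
  assumes "g \<in> carrier G"
  obtains c where "continuous_on {0..1::real} c" "c ` {0..1} \<subseteq> carrier G" "c 0 = \<one>" "c 1 = g"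
proof -
  obtain h where h: "continuous_on ({0..1::real} \<times> {0..1::real}) h" "h ` ({0..1} \<times> {0..1}) \<subseteq> carrier G"
    "\<And>x. x \<in> {0..1} \<Longrightarrow> h (0, x) = \<one>" "\<And>x. x \<in> {0..1} \<Longrightarrow> h (1, x) = g"
    by (rule null_homotopic_loop[of "\<lambda>_. \<one>" g]) (use assms in auto)
  show ?thesis
  proof (rule that[of "\<lambda>s. h (s, 0)"])
    show "continuous_on {0..1} (\<lambda>s. h (s, 0))"
      by (rule continuous_on_compose2[OF h(1)]) (auto intro!: continuous_intros)
  qed (use h in auto)
qed

text \<open>A loop in the simply connected group has no monodromy in the logarithm of the determinant:
  the logarithm extends over the square of a null homotopy.\<close>

lemma loop_log_symplectic_det:
  assumes c: "continuous_on {0..1} c" "c ` {0..1} \<subseteq> carrier G" "c 0 = c 1"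
    and b: "continuous_on {0..1::real} b" "\<And>s. s \<in> {0..1} \<Longrightarrow> symplectic_det (p (c s)) = exp (b s)"
  shows "b 1 = b 0"
proof -
  let ?Q = "{0..1::real} \<times> {0..1::real}"
  obtain h where h: "continuous_on ?Q h" "h ` ?Q \<subseteq> carrier G"
    "\<And>x. x \<in> {0..1} \<Longrightarrow> h (0, x) = c x" "\<And>x. x \<in> {0..1} \<Longrightarrow> h (1, x) = \<one>"
    "\<And>s. s \<in> {0..1} \<Longrightarrow> h (s, 0) = h (s, 1)"
    using null_homotopic_loop[OF c G.one_closed] by metis
  have "continuous_on ?Q (\<lambda>z. symplectic_det (p (h z)))"
    by (intro continuous_intros continuous_on_p h)
  moreover have "contractible ?Q"
    by (intro convex_imp_contractible convex_Times) auto
  moreover have nz: "symplectic_det (p (h z)) \<noteq> 0" if "z \<in> ?Q" for z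
    using h(2) that by (intro symplectic_det_nonzero p_in_Sp) auto
  ultimately obtain B where B: "continuous_on ?Q B"
    "\<And>z. z \<in> ?Q \<Longrightarrow> symplectic_det (p (h z)) = exp (B z)"
    using continuous_logarithm_on_contractible by (metis (no_types, lifting))
  have nzc: "symplectic_det (p (c s)) \<noteq> 0" if "s \<in> {0..1}" for s
    using nz[of "(0, s)"] h(3) that by simp
  \<comment> \<open>Values with exponential 1 lie in 2 pi i Z, where distinct points are at least 2
    pi apart.\<close>
  have const: "f x = f y" if f: "continuous_on {0..1::real} f" "\<And>x. x \<in> {0..1} \<Longrightarrow> exp (f x) = (1::complex)"
    and xy: "x \<in> {0..1}" "y \<in> {0..1}" for f x y
  proof -
    have "\<exists>k. \<forall>x\<in>{0..1}. f x = k"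
    proof (rule continuous_discrete_range_constant[OF _ f(1), unfolded constant_on_def])
      fix x :: real assume x: "x \<in> {0..1}"
      show "\<exists>e>0. \<forall>y. y \<in> {0..1} \<and> f y \<noteq> f x \<longrightarrow> e \<le> norm (f y - f x)"
      proof (intro exI[of _ "2 * pi"] conjI allI impI)
        fix y :: real assume y: "y \<in> {0..1} \<and> f y \<noteq> f x"
        obtain m :: int where m: "Re (f x) = 0" "Im (f x) = of_int (2 * m) * pi"
          using f(2)[OF x] exp_eq_1 by blast
        obtain n :: int where n: "Re (f y) = 0" "Im (f y) = of_int (2 * n) * pi"
          using f(2)[of y] y exp_eq_1 by blast
        have "f y - f x = complex_of_real (2 * pi * of_int (n - m)) * \<i>"
          using m n by (simp add: complex_eq_iff algebra_simps)
        moreover from this y have "n \<noteq> m" by auto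
        then have "1 \<le> \<bar>real_of_int (n - m)\<bar>" by linarith
        then have "2 * pi * 1 \<le> 2 * pi * \<bar>real_of_int (n - m)\<bar>"
          by (intro mult_left_mono) auto
        ultimately show "2 * pi \<le> norm (f y - f x)"
          by (simp add: norm_mult abs_mult del: of_int_diff)
      qed auto
    qed auto
    then show ?thesis using xy by metis
  qed
  have edge: "continuous_on {0..1} (\<lambda>s. B (s, x))" "continuous_on {0..1} (\<lambda>s. B (x, s))"
    if "x \<in> {0..1}" for x
    by (rule continuous_on_compose2[OF B(1)]; use that in \<open>auto intro!: continuous_intros\<close>)+
  \<comment> \<open>Each stage of the homotopy is a loop, so the change of the logarithm along it
    lies in 2 pi i Z and is the same at all stages. At the last stage the loop is constant and the
    change is 0.\<close>
  have "B (0, 1) - B (0, 0) = B (1, 1) - B (1, 0)"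
    by (rule const[of "\<lambda>s. B (s, 1) - B (s, 0)"])
      (auto intro!: continuous_intros edge simp: exp_diff h(5) nz simp flip: B(2))
  also have "B (1, 1) - 0 = B (1, 0) - 0"
    by (rule const[of "\<lambda>x. B (1, x) - 0"])
      (auto intro!: continuous_intros edge simp: h(4) symplectic_det_unitary_embedding[of "mat 1", simplified] simp flip: B(2))
  then have "B (1, 1) - B (1, 0) = 0"
    by simp
  finally have "B (0, 1) = B (0, 0)"
    by simp
  \<comment> \<open>On the initial loop, \<open>b\<close> and \<open>B\<close> are logarithms of the
    same function, so they differ by a constant.\<close>
  moreover have "B (0, 1) - b 1 = B (0, 0) - b 0"
    by (rule const[of "\<lambda>x. B (0, x) - b x"])
      (auto intro!: continuous_intros edge b(1) simp: exp_diff h(3) nzc simp flip: B(2) b(2))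
  ultimately show ?thesis by simp
qed

text \<open>Scaling the angle contracts the rotations to the identity. The end of the lifted
  contraction is the wanted lift, and at angle 0 the contraction is constant.\<close>

lemma rotation_lift_interval:
  obtains c where "continuous_on {-T..T} c" "c ` {-T..T} \<subseteq> carrier G" "c 0 = \<one>"
    "\<And>t. t \<in> {-T..T} \<Longrightarrow> p (c t) = rotation t"
proof -
  obtain F where F: "continuous_on ({0..1} \<times> {-T..T}) F" "F ` ({0..1} \<times> {-T..T}) \<subseteq> carrier G"
    "\<And>s y. s \<in> {0..1} \<Longrightarrow> y \<in> {-T..T} \<Longrightarrow> p (F (s, y)) = (\<lambda>z. rotation (fst z * snd z)) (s, y)"
    "\<And>y. y \<in> {-T..T} \<Longrightarrow> (\<And>s. s \<in> {0..1} \<Longrightarrow> (\<lambda>z. rotation (fst z * snd z)) (s, y) =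
       (\<one>\<^bsub>Sp\<^esub> :: real^('n + 'n)^('n + 'n))) \<Longrightarrow> F (1, y) = \<one>"
  proof (rule lift_homotopy_from_one[of "{-T..T}" "\<lambda>z. rotation (fst z * snd z)"])
    show "continuous_on ({0..1} \<times> {- T..T}) (\<lambda>z. rotation (fst z * snd z) :: real^('n + 'n)^('n + 'n))"
      by (intro continuous_intros)
  qed (use rotation_unitary in \<open>auto simp: unitary_part_def\<close>)
  \<comment> \<open>For T < 0 the interval is empty but \<open>c 0\<close> must still be the
    identity, whence the default value.\<close>
  define c where "c t = (if 0 \<le> T then F (1, t) else \<one>)" for t
  show ?thesis
  proof (rule that[of c])
    show "continuous_on {-T..T} c"
      unfolding c_def by (cases "0 \<le> T")
        (auto intro!: continuous_intros continuous_on_compose2[OF F(1)])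
    show "c 0 = \<one>"
      using F(4)[of 0] by (simp add: c_def)
  qed (use F in \<open>auto simp: c_def\<close>)
qed

lemma rotation_lift:
  obtains \<sigma> where "continuous_on UNIV \<sigma>" "range \<sigma> \<subseteq> carrier G" "\<sigma> 0 = \<one>"
    "\<And>t. p (\<sigma> t) = rotation t"
proof -
  have "\<exists>c. continuous_on {-T..T} c \<and> c ` {-T..T} \<subseteq> carrier G \<and> c 0 = \<one> \<and>
      (\<forall>t\<in>{-T..T}. p (c t) = rotation t)" for T
    by (rule rotation_lift_interval[of T]) blast
  then obtain c where c: "\<And>T. continuous_on {-T..T} (c T)" "\<And>T. c T ` {-T..T} \<subseteq> carrier G" "\<And>T. c T 0 = \<one>"
    "\<And>T t. t \<in> {-T..T} \<Longrightarrow> p (c T t) = rotation t"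
    by metis
  \<comment> \<open>By uniqueness the lifts over nested intervals agree, so choosing the interval of
    radius \<open>\<bar>t\<bar>\<close> at each \<open>t\<close> gives one function, which is
    continuous because it agrees with a fixed lift on each open interval.\<close>
  have eq: "c \<bar>t\<bar> t = c T t" if "\<bar>t\<bar> \<le> T" for t T
  proof (rule unique_lift[of "{-\<bar>t\<bar>..\<bar>t\<bar>}" "c \<bar>t\<bar>" "c T" 0])
    have sub: "{-\<bar>t\<bar>..\<bar>t\<bar>} \<subseteq> {-T..T}" using that by auto
    then show "continuous_on {-\<bar>t\<bar>..\<bar>t\<bar>} (c T)" "c T ` {-\<bar>t\<bar>..\<bar>t\<bar>} \<subseteq> carrier G"
      using c(1)[of T] c(2)[of T] by (auto intro: continuous_on_subset)
    show "p (c \<bar>t\<bar> x) = p (c T x)" if "x \<in> {-\<bar>t\<bar>..\<bar>t\<bar>}" for x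
      using that sub c(4)[of x "\<bar>t\<bar>"] c(4)[of x T] by auto
  qed (use c in auto)
  show ?thesis
  proof (rule that[of "\<lambda>t. c \<bar>t\<bar> t"])
    have "continuous_on {-T<..<T} (\<lambda>t. c \<bar>t\<bar> t)" for T
      by (rule continuous_on_eq[OF continuous_on_subset[OF c(1)[of T]]]) (auto intro!: eq[symmetric])
    then have "continuous_on (\<Union>T. {-T<..<T}) (\<lambda>t. c \<bar>t\<bar> t)"
      by (intro continuous_on_open_UN) auto
    moreover have "(\<Union>T. {-T<..<T}) = (UNIV :: real set)"
    proof -
      have "x \<in> {-(\<bar>x\<bar> + 1)<..<\<bar>x\<bar> + 1}" for x :: real by auto
      then show ?thesis by blast
    qed
    ultimately show "continuous_on UNIV (\<lambda>t. c \<bar>t\<bar> t)" by simp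
    have "c \<bar>t\<bar> t \<in> carrier G" for t
      using c(2)[of "\<bar>t\<bar>"] by force
    then show "range (\<lambda>t. c \<bar>t\<bar> t) \<subseteq> carrier G" by auto
    show "p (c \<bar>t\<bar> t) = rotation t" for t
      by (rule c(4)) (auto simp: abs_if)
  qed (use c in auto)
qed

end


section \<open>The angle on the cover of the unitary group\<close>

locale symplectic_cover_rotation = symplectic_cover G p
  for G :: "('g::topological_space, 'm) monoid_scheme" (structure)
    and p :: "'g \<Rightarrow> real^('n::finite + 'n)^('n + 'n)" +
  fixes \<sigma> :: "real \<Rightarrow> 'g"
  assumes \<sigma>_continuous: "continuous_on UNIV \<sigma>"
    and \<sigma>_range: "range \<sigma> \<subseteq> carrier G"
    and \<sigma>_0 [simp]: "\<sigma> 0 = \<one>"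
    and p_\<sigma>: "p (\<sigma> t) = rotation t"
begin

lemma \<sigma>_closed [simp]: "\<sigma> t \<in> carrier G"
  using \<sigma>_range by auto

lemma continuous_on_\<sigma>: "continuous_on S f \<Longrightarrow> continuous_on S (\<lambda>x. \<sigma> (f x))"
  by (rule continuous_on_compose2[OF \<sigma>_continuous]) auto

text \<open>As functions of \<open>t\<close>, both sides lift the same path of rotations and agree
  at 0.\<close>

lemma \<sigma>_add: "\<sigma> (s + t) = \<sigma> s \<otimes> \<sigma> t"
proof (rule unique_lift[of UNIV "\<lambda>t. \<sigma> (s + t)" "\<lambda>t. \<sigma> s \<otimes> \<sigma> t" 0])
  show "continuous_on UNIV (\<lambda>t. \<sigma> s \<otimes> \<sigma> t)"
    by (intro continuous_on_G_mult continuous_on_\<sigma> continuous_intros) auto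
qed (auto intro!: continuous_on_\<sigma> continuous_intros simp: p_\<sigma> rotation_add)

lemma inv_\<sigma>: "inv (\<sigma> t) = \<sigma> (- t)"
  by (rule G.inv_equality) (simp_all flip: \<sigma>_add)

definition unitary_cover :: "'g set" where
  "unitary_cover = {g \<in> carrier G. p g \<in> unitary_part}"

lemma unitary_cover_carrier: "k \<in> unitary_cover \<Longrightarrow> k \<in> carrier G"
  by (simp add: unitary_cover_def)

lemma unitary_cover_subgroup: "subgroup unitary_cover G"
  by (rule G.subgroupI)
    (auto simp: unitary_cover_def unitary_part_mult unitary_part_inverse mat_1_unitary Sp_inv_eq p_in_Sp
      intro!: exI[of _ \<one>])

lemma \<sigma>_unitary [simp]: "\<sigma> t \<in> unitary_cover"
  by (simp add: unitary_cover_def p_\<sigma> rotation_unitary)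

text \<open>A relation first, because independence of the path is only proved below. The real
  \<open>t\<close> is the total change of the argument of the determinant along the path, divided by
  n so that \<open>\<sigma> t\<close> gets angle \<open>t\<close>.\<close>

definition angle :: "'g \<Rightarrow> real \<Rightarrow> bool" where
  "angle k t \<longleftrightarrow> (\<exists>c b. continuous_on {0..1::real} c \<and> c ` {0..1} \<subseteq> unitary_cover \<and> c 0 = \<one> \<and> c 1 = k \<and>
     continuous_on {0..1} b \<and> b 0 = 0 \<and> b 1 = t \<and>
     (\<forall>s\<in>{0..1}. symplectic_det (p (c s)) = exp (\<i> * complex_of_real (real CARD('n) * b s))))"

text \<open>A path in \<open>G\<close> is multiplied pointwise by the final stage of the lifted
  polar homotopy. Both endpoints already lie over U(n), so they are multiplied by the
  identity.\<close>

lemma unitary_cover_path: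
  assumes "k \<in> unitary_cover"
  obtains c where "continuous_on {0..1::real} c" "c ` {0..1} \<subseteq> unitary_cover" "c 0 = \<one>" "c 1 = k"
proof -
  obtain c where c: "continuous_on {0..1::real} c" "c ` {0..1} \<subseteq> carrier G" "c 0 = \<one>" "c 1 = k"
    using path_from_one assms unitary_cover_carrier by metis
  have cG: "c y \<in> carrier G" if "y \<in> {0..1}" for y
    using c(2) that by auto
  obtain h where h: "continuous_on ({0..1} \<times> {0..1}) h" "h ` ({0..1} \<times> {0..1}) \<subseteq> carrier Sp"
    "\<And>y. y \<in> {0..1} \<Longrightarrow> h (0::real, y) = mat 1"
    "\<And>y. y \<in> {0..1} \<Longrightarrow> h (1, y) ** p (c y) \<in> unitary_part"
    "\<And>s y. y \<in> {0..1} \<Longrightarrow> p (c y) \<in> unitary_part \<Longrightarrow> h (s, y) = mat 1"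
  proof (rule polar_homotopy[of "{0..1::real}" "\<lambda>y. p (c y)"])
    show "continuous_on {0..1} (\<lambda>y. p (c y))"
      using c by (intro continuous_on_p)
    show "(\<lambda>y. p (c y)) ` {0..1} \<subseteq> carrier Sp"
      using p_in_Sp cG by auto
  qed auto
  obtain F where F: "continuous_on ({0..1} \<times> {0..1}) F" "F ` ({0..1} \<times> {0..1}) \<subseteq> carrier G"
    "\<And>s y. s \<in> {0..1} \<Longrightarrow> y \<in> {0..1} \<Longrightarrow> p (F (s, y)) = h (s, y)"
    "\<And>y. y \<in> {0..1} \<Longrightarrow> (\<And>s. s \<in> {0..1} \<Longrightarrow> h (s, y) = mat 1) \<Longrightarrow> F (1, y) = \<one>"
    using lift_homotopy_from_one[of "{0..1::real}" h] h(1-3) by (metis Sp_simps(2) compact_Icc)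
  have F1: "F (1, y) \<in> carrier G" if "y \<in> {0..1}" for y
    using F(2) that by auto
  have "F (1, y) = \<one>" if "y = 0 \<or> y = 1" for y
    using that assms c by (intro F(4) h(5)) (auto simp: unitary_cover_def mat_1_unitary)
  then have "F (1, 0) \<otimes> c 0 = \<one>" "F (1, 1) \<otimes> c 1 = k"
    using c assms unitary_cover_carrier by auto
  moreover have "continuous_on {0..1} (\<lambda>y. F (1, y))"
    by (rule continuous_on_compose2[OF F(1)]) (auto intro!: continuous_intros)
  then have "continuous_on {0..1} (\<lambda>y. F (1, y) \<otimes> c y)"
    using c F1 by (intro continuous_on_G_mult) auto
  moreover have "(\<lambda>y. F (1, y) \<otimes> c y) ` {0..1} \<subseteq> unitary_cover"
    using F(3) F1 cG h(4) by (auto simp: unitary_cover_def)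
  ultimately show ?thesis
    using that[of "\<lambda>y. F (1, y) \<otimes> c y"] by simp
qed

lemma angle_exists:
  assumes "k \<in> unitary_cover"
  obtains t where "angle k t"
proof -
  obtain c where c: "continuous_on {0..1::real} c" "c ` {0..1} \<subseteq> unitary_cover" "c 0 = \<one>" "c 1 = k"
    using unitary_cover_path assms by metis
  let ?D = "\<lambda>s. symplectic_det (p (c s))"
  have "c s \<in> unitary_cover" if "s \<in> {0..1}" for s
    using c(2) that by blast
  then have cu: "c s \<in> carrier G" "p (c s) \<in> unitary_part" if "s \<in> {0..1}" for s
    using that by (auto simp: unitary_cover_def)
  have "continuous_on {0..1} ?D"
    using c cu by (intro continuous_intros continuous_on_p) auto
  moreover have "contractible {0..1::real}"
    by (intro convex_imp_contractible) auto
  moreover have nz: "?D s \<noteq> 0" if "s \<in> {0..1}" for s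
    using norm_symplectic_det[OF cu(2)[OF that]] by auto
  ultimately obtain g where g: "continuous_on {0..1} g" "\<And>s. s \<in> {0..1} \<Longrightarrow> ?D s = exp (g s)"
    using continuous_logarithm_on_contractible by (metis (no_types, lifting))
  have Re: "Re (g s) = 0" if "s \<in> {0..1}" for s
    using norm_symplectic_det[OF cu(2)[OF that]] g(2)[OF that] by simp
  \<comment> \<open>The logarithm is purely imaginary, and its initial value is a multiple of 2 pi
    i. Subtracting that value makes \<open>b\<close> start at 0 without changing the
    exponential.\<close>
  define b where "b s = Im (g s - g 0) / real CARD('n)" for s
  have "exp (\<i> * complex_of_real (real CARD('n) * b s)) = ?D s" if s: "s \<in> {0..1}" for s
  proof -
    have "\<i> * complex_of_real (real CARD('n) * b s) = g s - g 0"
      using Re[of s] Re[of 0] s by (simp add: b_def complex_eq_iff)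
    moreover have "exp (g 0) = 1"
      using g(2)[of 0] c(3) symplectic_det_unitary_embedding[of "mat 1 :: complex^'n^'n"] by simp
    ultimately show ?thesis
      by (simp add: exp_diff g(2)[OF s])
  qed
  moreover have "continuous_on {0..1} b"
    unfolding b_def by (intro continuous_intros g) auto
  moreover have "b 0 = 0"
    by (simp add: b_def)
  ultimately have "angle k (b 1)"
    unfolding angle_def using c by (intro exI[of _ c] exI[of _ b]) auto
  then show ?thesis ..
qed

text \<open>The witness is the pointwise product of the two paths. It stays over U(n), where the
  determinant is multiplicative.\<close>

lemma angle_mult:
  assumes "angle k s" "angle l t"
  shows "angle (k \<otimes> l) (s + t)"
proof -
  obtain c b where c: "continuous_on {0..1::real} c" "c ` {0..1} \<subseteq> unitary_cover" "c 0 = \<one>" "c 1 = k"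
    "continuous_on {0..1} b" "b 0 = 0" "b 1 = s"
    "\<And>r. r \<in> {0..1} \<Longrightarrow> symplectic_det (p (c r)) = exp (\<i> * complex_of_real (real CARD('n) * b r))"
    using assms(1) unfolding angle_def by metis
  obtain d e where d: "continuous_on {0..1::real} d" "d ` {0..1} \<subseteq> unitary_cover" "d 0 = \<one>" "d 1 = l"
    "continuous_on {0..1} e" "e 0 = 0" "e 1 = t"
    "\<And>r. r \<in> {0..1} \<Longrightarrow> symplectic_det (p (d r)) = exp (\<i> * complex_of_real (real CARD('n) * e r))"
    using assms(2) unfolding angle_def by metis
  have u: "c r \<in> unitary_cover" "d r \<in> unitary_cover" if "r \<in> {0..1}" for r
    using c(2) d(2) that by auto
  have "continuous_on {0..1} (\<lambda>r. c r \<otimes> d r)"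
    using c d u unitary_cover_carrier by (intro continuous_on_G_mult) auto
  moreover have "(\<lambda>r. c r \<otimes> d r) ` {0..1} \<subseteq> unitary_cover"
    using u subgroup.m_closed[OF unitary_cover_subgroup] by auto
  moreover have "symplectic_det (p (c r \<otimes> d r)) = exp (\<i> * complex_of_real (real CARD('n) * (b r + e r)))"
    if "r \<in> {0..1}" for r
    using u[OF that] c(8)[OF that] d(8)[OF that]
    by (simp add: unitary_cover_def symplectic_det_mult distrib_left exp_add)
  ultimately show ?thesis
    unfolding angle_def using c d
    by (intro exI[of _ "\<lambda>r. c r \<otimes> d r"] exI[of _ "\<lambda>r. b r + e r"]) (auto intro!: continuous_intros)
qed

lemma angle_unitary_cover: "angle k t \<Longrightarrow> k \<in> unitary_cover"
  unfolding angle_def by force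

lemma angle_det: "angle k t \<Longrightarrow> symplectic_det (p k) = exp (\<i> * complex_of_real (real CARD('n) * t))"
  unfolding angle_def by force

lemma angle_one_imp_0:
  assumes "angle \<one> t"
  shows "t = 0"
proof -
  obtain c b where c: "continuous_on {0..1::real} c" "c ` {0..1} \<subseteq> unitary_cover" "c 0 = \<one>" "c 1 = \<one>"
    "continuous_on {0..1} b" "b 0 = 0" "b 1 = t"
    "\<And>r. r \<in> {0..1} \<Longrightarrow> symplectic_det (p (c r)) = exp (\<i> * complex_of_real (real CARD('n) * b r))"
    using assms unfolding angle_def by metis
  have "(\<lambda>r. \<i> * complex_of_real (real CARD('n) * b r)) 1 = (\<lambda>r. \<i> * complex_of_real (real CARD('n) * b r)) 0"
    by (rule loop_log_symplectic_det[of c])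
      (use c unitary_cover_carrier in \<open>auto intro!: continuous_intros\<close>)
  then show ?thesis
    using c by simp
qed

lemma angle_\<sigma>: "angle (\<sigma> t) t"
  unfolding angle_def
  by (intro exI[of _ "\<lambda>s. \<sigma> (s * t)"] exI[of _ "\<lambda>s. s * t"])
    (auto intro!: continuous_on_\<sigma> continuous_intros simp: p_\<sigma> symplectic_det_rotation)

text \<open>Multiplying by any angle of the inverse of \<open>k\<close> reduces the claim to the
  identity, where the paths are loops without monodromy.\<close>

lemma angle_unique:
  assumes "angle k s" "angle k t"
  shows "s = t"
proof -
  have k: "k \<in> unitary_cover"
    using assms angle_unitary_cover by blast
  then obtain r where r: "angle (inv k) r"
    using angle_exists subgroup.m_inv_closed[OF unitary_cover_subgroup] by metis
  have "angle \<one> (s + r)" "angle \<one> (t + r)"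
    using angle_mult[OF assms(1) r] angle_mult[OF assms(2) r] unitary_cover_carrier[OF k] by simp_all
  then have "s + r = 0" "t + r = 0"
    by (blast intro: angle_one_imp_0)+
  then show ?thesis
    by simp
qed

definition \<alpha> :: "'g \<Rightarrow> real" where
  "\<alpha> k = (THE t. angle k t)"

lemma \<alpha>_eq: "angle k t \<Longrightarrow> \<alpha> k = t"
  unfolding \<alpha>_def using angle_unique by blast

lemma angle_\<alpha>: "k \<in> unitary_cover \<Longrightarrow> angle k (\<alpha> k)"
  using angle_exists \<alpha>_eq by metis

lemma \<alpha>_mult: "k \<in> unitary_cover \<Longrightarrow> l \<in> unitary_cover \<Longrightarrow> \<alpha> (k \<otimes> l) = \<alpha> k + \<alpha> l"
  by (intro \<alpha>_eq angle_mult angle_\<alpha>)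

lemma \<alpha>_\<sigma> [simp]: "\<alpha> (\<sigma> t) = t"
  by (rule \<alpha>_eq[OF angle_\<sigma>])

lemma \<alpha>_one [simp]: "\<alpha> \<one> = 0"
  using \<alpha>_\<sigma>[of 0] by simp

text \<open>Near the identity, the lift of \<^const>\<open>unitary_path\<close> through a local section joins \<open>\<one>\<close> to \<open>k\<close>
  within the domain of the principal logarithm of the determinant.\<close>

lemma \<alpha>_near_one:
  obtains V where "openin (top_of_set unitary_cover) V" "\<one> \<in> V"
    "\<And>k. k \<in> V \<Longrightarrow> 0 < Re (symplectic_det (p k)) \<and>
       \<alpha> k = Im (Ln (symplectic_det (p k))) / real CARD('n)"
proof -
  obtain U T q where U: "\<one> \<in> U" "openin (top_of_set (carrier G)) U"
    and T: "\<one>\<^bsub>Sp\<^esub> \<in> T" "openin (top_of_set (carrier Sp)) T"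
    and q: "continuous_on T q" "q ` T \<subseteq> U" "\<And>x. x \<in> U \<Longrightarrow> p x \<in> T" "\<And>x. x \<in> U \<Longrightarrow> q (p x) = x"
      "\<And>y. y \<in> T \<Longrightarrow> p (q y) = y"
    by (rule local_section) blast
  have UG: "U \<subseteq> carrier G"
    using openin_imp_subset[OF U(2)] .
  have q1: "q (mat 1) = \<one>"
    using q(4)[OF U(1)] by simp
  obtain e1 where e1: "0 < e1" "\<And>M. M \<in> carrier Sp \<Longrightarrow> dist M (mat 1) < e1 \<Longrightarrow> M \<in> T"
    using T unfolding openin_euclidean_subtopology_iff by auto
  have det1: "symplectic_det (mat 1 :: real^('n + 'n)^('n + 'n)) = 1"
    using symplectic_det_unitary_embedding[of "mat 1 :: complex^'n^'n"] by simp
  have "open {M :: real^('n + 'n)^('n + 'n). 0 < Re (symplectic_det M)}"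
    by (intro open_Collect_less continuous_intros)
  then obtain e2 where e2: "0 < e2"
    "\<And>M :: real^('n + 'n)^('n + 'n). dist M (mat 1) < e2 \<Longrightarrow> 0 < Re (symplectic_det M)"
    using det1 unfolding open_dist by (metis mem_Collect_eq one_complex.simps(1) zero_less_one)
  obtain e3 where e3: "0 < e3" "\<And>M :: real^('n + 'n)^('n + 'n). dist M (mat 1) \<le> e3 \<Longrightarrow>
       2 *\<^sub>R mat 1 - M - transpose M \<in> contractions (1/2)"
    using contractions_near_1 by metis
  let ?B = "cball (mat 1 :: real^('n + 'n)^('n + 'n)) e3"
  let ?u = "\<lambda>z. unitary_path (fst z) (snd z) :: real^('n + 'n)^('n + 'n)"
  have cont: "continuous_on ({0..1} \<times> ?B) ?u"
    by (rule continuous_on_subset[OF continuous_on_unitary_path]) (use e3(2) in \<open>auto simp: dist_commute\<close>)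
  then have "uniformly_continuous_on ({0..1} \<times> ?B) ?u"
    by (intro compact_uniformly_continuous compact_Times) auto
  then obtain d where d: "0 < d" "\<And>z w. z \<in> {0..1} \<times> ?B \<Longrightarrow> w \<in> {0..1} \<times> ?B \<Longrightarrow> dist w z < d \<Longrightarrow>
       dist (?u w) (?u z) < min e1 e2"
    unfolding uniformly_continuous_on_def using e1(1) e2(1) by (metis min_less_iff_conj)
  \<comment> \<open>\<open>unitary_path\<close> fixes the identity matrix at every time, so by
    uniform continuity the whole path stays near 1: \<open>e1\<close> keeps it in the domain of the
    section, \<open>e2\<close> keeps its determinant in the right half plane.\<close>
  have near: "dist (unitary_path s M) (mat 1) < min e1 e2"
    if "s \<in> {0..1}" "dist M (mat 1) < min d e3"
    for s and M :: "real^('n + 'n)^('n + 'n)"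
    using d(2)[of "(s, mat 1)" "(s, M)"] that e3(1)
    by (simp add: dist_Pair_Pair dist_commute)
  \<comment> \<open>Membership in \<open>U\<close> ensures that the path lifted by \<open>q\<close>
    ends at \<open>k\<close> itself and not at another point over \<open>p k\<close>.\<close>
  define V where "V = unitary_cover \<inter> U \<inter> (unitary_cover \<inter> p -` ball (mat 1) (min d e3))"
  have "openin (top_of_set unitary_cover) (unitary_cover \<inter> U)"
    using U(2) by (auto simp: openin_open unitary_cover_def)
  moreover have "continuous_on unitary_cover (\<lambda>k. p k)"
    by (intro continuous_on_p continuous_intros) (auto simp: unitary_cover_def)
  then have "openin (top_of_set unitary_cover) (unitary_cover \<inter> p -` ball (mat 1) (min d e3))"
    by (intro continuous_openin_preimage_gen) auto
  ultimately have "openin (top_of_set unitary_cover) V"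
    unfolding V_def by (rule openin_Int)
  moreover have "\<one> \<in> V"
    using U(1) d(1) e3(1) subgroup.one_closed[OF unitary_cover_subgroup] by (simp add: V_def)
  moreover have "0 < Re (symplectic_det (p k)) \<and> \<alpha> k = Im (Ln (symplectic_det (p k))) / real CARD('n)"
    if k: "k \<in> V" for k
  proof -
    let ?M = "p k"
    have M: "?M \<in> unitary_part" "dist ?M (mat 1) < min d e3" "k \<in> U"
      using k by (auto simp: V_def unitary_cover_def dist_commute)
    have u: "unitary_path s ?M \<in> unitary_part" if "s \<in> {0..1}" for s
      using M that by (intro unitary_path_in_unitary_part e3(2)) auto
    have uT: "unitary_path s ?M \<in> T" if "s \<in> {0..1}" for s
      using near[OF that M(2)] u[OF that] by (intro e1(2)) (auto simp: unitary_part_def)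
    have Re: "0 < Re (symplectic_det (unitary_path s ?M))" if "s \<in> {0..1}" for s
      using near[OF that M(2)] by (intro e2(2)) auto
    have "continuous_on {0..1} (\<lambda>s. ?u (s, ?M))"
    proof (rule continuous_on_compose2[OF cont])
      show "continuous_on {0..1} (\<lambda>s. (s, ?M))"
        by (intro continuous_intros)
    qed (use M(2) in \<open>auto simp: dist_commute\<close>)
    then have cu: "continuous_on {0..1} (\<lambda>s. unitary_path s ?M)"
      by simp
    define b where "b s = Im (Ln (symplectic_det (unitary_path s ?M))) / real CARD('n)" for s
    have "angle k (b 1)"
      unfolding angle_def
    proof (intro exI[of _ "\<lambda>s. q (unitary_path s ?M)"] exI[of _ b] conjI ballI)
      show "continuous_on {0..1} (\<lambda>s. q (unitary_path s ?M))"
        using uT by (intro continuous_on_compose2[OF q(1) cu]) auto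
      show "(\<lambda>s. q (unitary_path s ?M)) ` {0..1} \<subseteq> unitary_cover"
      proof (rule image_subsetI)
        fix s :: real assume s: "s \<in> {0..1}"
        have "q (unitary_path s ?M) \<in> carrier G"
          using uT[OF s] q(2) UG by blast
        then show "q (unitary_path s ?M) \<in> unitary_cover"
          using uT[OF s] u[OF s] q(5) by (simp add: unitary_cover_def)
      qed
      show "continuous_on {0..1} b"
        unfolding b_def
      proof (intro continuous_on_divide continuous_on_Im continuous_on_Ln' continuous_on_symplectic_det
          cu continuous_on_const)
        fix s :: real assume "s \<in> {0..1}"
        then show "symplectic_det (unitary_path s ?M) \<notin> \<real>\<^sub>\<le>\<^sub>0"
          using Re complex_nonpos_Reals_iff by force
      qed auto
      show "symplectic_det (p (q (unitary_path s ?M))) = exp (\<i> * complex_of_real (real CARD('n) * b s))"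
        if s: "s \<in> {0..1}" for s
      proof -
        let ?z = "symplectic_det (unitary_path s ?M)"
        have z: "?z \<noteq> 0" "norm ?z = 1"
          using norm_symplectic_det[OF u[OF s]] by auto
        have "\<i> * complex_of_real (real CARD('n) * b s) = Ln ?z"
          using z by (simp add: b_def complex_eq_iff Re_Ln)
        then have "exp (\<i> * complex_of_real (real CARD('n) * b s)) = ?z"
          using z by simp
        then show ?thesis
          using uT[OF s] q(5) by simp
      qed
    qed (use q1 q(4) M(3) det1 in \<open>auto simp: b_def\<close>)
    then have "\<alpha> k = b 1"
      by (rule \<alpha>_eq)
    then show ?thesis
      using Re[of 1] by (simp add: b_def)
  qed
  ultimately show ?thesis
    using that by blast
qed

text \<open>Near \<open>k\<close>, \<open>\<alpha>\<close> is the constant \<open>\<alpha> k\<close>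
  plus its values near the identity, reached by translation with the inverse of \<open>k\<close>.
  There it is given by the principal logarithm.\<close>

lemma continuous_on_\<alpha>: "continuous_on unitary_cover \<alpha>"
proof -
  obtain V where V: "openin (top_of_set unitary_cover) V" "\<one> \<in> V"
    "\<And>k. k \<in> V \<Longrightarrow> 0 < Re (symplectic_det (p k))"
    "\<And>k. k \<in> V \<Longrightarrow> \<alpha> k = Im (Ln (symplectic_det (p k))) / real CARD('n)"
    using \<alpha>_near_one by metis
  have VK: "V \<subseteq> unitary_cover"
    using openin_imp_subset[OF V(1)] .
  have "continuous_on V (\<lambda>k. Im (Ln (symplectic_det (p k))) / real CARD('n))"
  proof (intro continuous_on_divide continuous_on_Im continuous_on_Ln' continuous_on_symplectic_det
      continuous_on_p continuous_on_const continuous_on_id)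
    fix k assume "k \<in> V"
    then show "symplectic_det (p k) \<notin> \<real>\<^sub>\<le>\<^sub>0"
      using V(3) complex_nonpos_Reals_iff by force
  qed (use VK unitary_cover_carrier in auto)
  then have cV: "continuous_on V \<alpha>"
    by (rule continuous_on_eq) (simp add: V(4))
  have "\<exists>W. openin (top_of_set unitary_cover) W \<and> k \<in> W \<and> W \<subseteq> unitary_cover \<inter> \<alpha> -` A"
    if A: "open A" and k: "k \<in> unitary_cover" "\<alpha> k \<in> A" for A k
  proof -
    let ?t = "\<lambda>l. inv k \<otimes> l"
    have tK: "?t l \<in> unitary_cover" if "l \<in> unitary_cover" for l
      using that k subgroup.m_closed[OF unitary_cover_subgroup]
        subgroup.m_inv_closed[OF unitary_cover_subgroup] by simp
    have ct: "continuous_on unitary_cover ?t"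
      using k unitary_cover_carrier
      by (intro continuous_on_G_mult continuous_on_const continuous_on_id) auto
    have "openin (top_of_set V) (V \<inter> (\<lambda>l. \<alpha> k + \<alpha> l) -` A)"
      using cV A by (intro continuous_openin_preimage_gen continuous_intros)
    then have "openin (top_of_set unitary_cover) (V \<inter> (\<lambda>l. \<alpha> k + \<alpha> l) -` A)"
      using V(1) openin_trans by blast
    then have opn: "openin (top_of_set unitary_cover) (unitary_cover \<inter> ?t -` (V \<inter> (\<lambda>l. \<alpha> k + \<alpha> l) -` A))"
      using ct tK by (intro continuous_openin_preimage[where T = unitary_cover]) auto
    have \<alpha>_translate: "\<alpha> l = \<alpha> k + \<alpha> (?t l)" if "l \<in> unitary_cover" for l
      using \<alpha>_mult[OF k(1) tK[OF that]] that k unitary_cover_carrier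
      by (simp flip: G.m_assoc)
    have "?t k = \<one>"
      using k unitary_cover_carrier by simp
    then have "k \<in> unitary_cover \<inter> ?t -` (V \<inter> (\<lambda>l. \<alpha> k + \<alpha> l) -` A)"
      using V(2) k by simp
    moreover have "unitary_cover \<inter> ?t -` (V \<inter> (\<lambda>l. \<alpha> k + \<alpha> l) -` A) \<subseteq> unitary_cover \<inter> \<alpha> -` A"
    proof
      fix l assume "l \<in> unitary_cover \<inter> ?t -` (V \<inter> (\<lambda>l. \<alpha> k + \<alpha> l) -` A)"
      then have "l \<in> unitary_cover" "\<alpha> k + \<alpha> (?t l) \<in> A"
        by auto
      then show "l \<in> unitary_cover \<inter> \<alpha> -` A"
        using \<alpha>_translate[of l] by simp
    qed
    ultimately show ?thesis
      using opn by (intro exI[of _ "unitary_cover \<inter> ?t -` (V \<inter> (\<lambda>l. \<alpha> k + \<alpha> l) -` A)"] conjI)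
  qed
  then have "openin (top_of_set unitary_cover) (unitary_cover \<inter> \<alpha> -` A)" if "open A" for A
    using that by (subst openin_subopen) blast
  then show ?thesis
    by (auto simp: continuous_openin_preimage_eq)
qed

end


section \<open>The central extension\<close>

lemma real_group_simps [simp]:
  "carrier real_group = UNIV" "x \<otimes>\<^bsub>real_group\<^esub> y = x + y" "\<one>\<^bsub>real_group\<^esub> = 0"
  by (simp_all add: real_group_def)

lemma real_group_group: "Group.group real_group"
  by (rule groupI) (auto intro: exI[of _ "- x" for x])

lemma short_exact_iso_comp:
  assumes f: "f \<in> iso A' A" and exact: "short_exact A B C g h" and A': "Group.group A'"
  shows "short_exact A' B C (\<lambda>x. g (f x)) h"
proof -
  have f': "f \<in> hom A' A" "inj_on f (carrier A')" "f ` carrier A' = carrier A"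
    using f by (auto simp: iso_def bij_betw_def)
  have g: "g \<in> hom A B" "inj_on g (carrier A)"
    using exact by (auto simp: short_exact_def mon_def)
  have "g \<circ> f \<in> hom A' B"
    using f'(1) g(1) by (rule Group.hom_compose)
  moreover have "inj_on (g \<circ> f) (carrier A')"
    using f' g by (intro comp_inj_on) auto
  moreover have "(\<lambda>x. g (f x)) ` carrier A' = g ` carrier A"
    unfolding f'(3)[symmetric] by (simp add: image_image)
  ultimately show ?thesis
    using exact A' by (simp add: short_exact_def mon_def o_def)
qed

lemma center_commute: "z \<in> center G \<Longrightarrow> g \<in> carrier G \<Longrightarrow> z \<otimes>\<^bsub>G\<^esub> g = g \<otimes>\<^bsub>G\<^esub> z"
  by (simp add: center_def)

lemma center_normal:
  fixes G (structure)
  assumes "Group.group G"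
  shows "center G \<lhd> G"
proof -
  interpret group G by fact
  show ?thesis
  proof (rule normal_invI)
    show "subgroup (center G) G"
    proof (rule subgroupI)
      show "center G \<noteq> {}"
        by (auto simp: center_def)
    next
      fix a assume a: "a \<in> center G"
      show "inv a \<in> center G"
        unfolding center_def
      proof (intro CollectI conjI ballI)
        show "inv a \<in> carrier G" using a by (simp add: center_def)
        fix g assume g: "g \<in> carrier G"
        have "a \<otimes> inv g = inv g \<otimes> a"
          using a g by (simp add: center_def)
        then have "inv (a \<otimes> inv g) = inv (inv g \<otimes> a)"
          by simp
        moreover have "a \<in> carrier G"
          using a by (simp add: center_def)
        ultimately show "inv a \<otimes> g = g \<otimes> inv a"
          using g by (simp add: inv_mult_group)
      qed
    next
      fix a b assume ab: "a \<in> center G" "b \<in> center G"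
      then have c: "a \<in> carrier G" "b \<in> carrier G"
        by (auto simp: center_def)
      have "a \<otimes> b \<otimes> g = g \<otimes> (a \<otimes> b)" if g: "g \<in> carrier G" for g
      proof -
        have "a \<otimes> b \<otimes> g = a \<otimes> (b \<otimes> g)"
          using c g by (rule m_assoc)
        also have "b \<otimes> g = g \<otimes> b"
          using ab(2) g by (simp add: center_def)
        also have "a \<otimes> (g \<otimes> b) = a \<otimes> g \<otimes> b"
          using c g by (simp add: m_assoc)
        also have "a \<otimes> g = g \<otimes> a"
          using ab(1) g by (simp add: center_def)
        finally show ?thesis
          using c g by (simp add: m_assoc)
      qed
      then show "a \<otimes> b \<in> center G"
        using c by (simp add: center_def)
    qed (auto simp: center_def)
    fix x h assume x: "x \<in> carrier G" and h: "h \<in> center G"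
    then have "x \<otimes> h = h \<otimes> x" "h \<in> carrier G"
      by (auto simp: center_def)
    then have "x \<otimes> h \<otimes> inv x = h"
      using x by (simp add: m_assoc)
    with h show "x \<otimes> h \<otimes> inv x \<in> center G"
      by simp
  qed
qed

text \<open>\<open>N\<close> is the graph of the inverse of \<open>\<iota>\<close> over the center,
  hence central as \<open>Q\<close> is abelian. It meets the second factor trivially, which gives
  injectivity; it projects into the center of \<open>G\<close>, so the projection to
  \<open>G Mod center G\<close> descends.\<close>

lemma central_product_exact:
  fixes G :: "('g, 'm) monoid_scheme" and Q :: "'q monoid"
  assumes G: "Group.group G" and Q: "Group.comm_group Q"
    and \<iota>: "\<iota> \<in> hom (G\<lparr>carrier := center G\<rparr>) Q"
  defines "N \<equiv> {(z, inv\<^bsub>Q\<^esub> (\<iota> z)) | z. z \<in> center G}"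
  defines "\<theta> \<equiv> \<lambda>x. N #>\<^bsub>G \<times>\<times> Q\<^esub> x"
  obtains \<eta> where "short_exact Q ((G \<times>\<times> Q) Mod N) (G Mod center G) (\<lambda>x. \<theta> (\<one>\<^bsub>G\<^esub>, x)) \<eta>"
    "\<And>g x. g \<in> carrier G \<Longrightarrow> x \<in> carrier Q \<Longrightarrow> \<eta> (\<theta> (g, x)) = center G #>\<^bsub>G\<^esub> g"
proof -
  interpret G: group G by fact
  interpret Q: comm_group Q by fact
  let ?P = "G \<times>\<times> Q" and ?Z = "center G"
  interpret P: group ?P
    by (rule DirProd_group[OF G Q.group_axioms])
  interpret Z: normal ?Z G
    by (rule center_normal[OF G])
  interpret \<iota>: group_hom "G\<lparr>carrier := ?Z\<rparr>" Q \<iota>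
    by (intro group_hom.intro group_hom_axioms.intro \<iota> Q.group_axioms
        G.subgroup_imp_group[OF Z.subgroup_axioms])
  have Zc: "z \<in> carrier G" "\<iota> z \<in> carrier Q" "\<And>g. g \<in> carrier G \<Longrightarrow> g \<otimes>\<^bsub>G\<^esub> z = z \<otimes>\<^bsub>G\<^esub> g"
    if z: "z \<in> ?Z" for z
  proof -
    show "z \<in> carrier G"
      using z by (rule Z.mem_carrier)
    show "\<iota> z \<in> carrier Q"
      using \<iota>.hom_closed[of z] z by simp
    show "g \<otimes>\<^bsub>G\<^esub> z = z \<otimes>\<^bsub>G\<^esub> g" if "g \<in> carrier G" for g
      using center_commute[OF z that] by simp
  qed
  have \<iota>_mult: "\<iota> (z \<otimes>\<^bsub>G\<^esub> w) = \<iota> z \<otimes>\<^bsub>Q\<^esub> \<iota> w" if "z \<in> ?Z" "w \<in> ?Z" for z w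
    using \<iota>.hom_mult[of z w] that by simp
  have \<iota>_inv: "\<iota> (inv\<^bsub>G\<^esub> z) = inv\<^bsub>Q\<^esub> (\<iota> z)" if "z \<in> ?Z" for z
    using \<iota>.hom_inv[of z] that G.m_inv_consistent[OF Z.subgroup_axioms that] by simp
  have \<iota>_one: "\<iota> \<one>\<^bsub>G\<^esub> = \<one>\<^bsub>Q\<^esub>"
    using \<iota>.hom_one by simp
  have "N \<lhd> ?P"
  proof (rule P.normal_invI)
    show "subgroup N ?P"
    proof (rule P.subgroupI)
      show "N \<subseteq> carrier ?P"
        using Zc by (auto simp: N_def)
      show "N \<noteq> {}"
        using Z.one_closed unfolding N_def by blast
      show "inv\<^bsub>?P\<^esub> a \<in> N" if "a \<in> N" for a
        using that Zc Z.m_inv_closed \<iota>_inv G.group_axioms Q.group_axioms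
        by (auto simp: N_def inv_DirProd)
      show "a \<otimes>\<^bsub>?P\<^esub> b \<in> N" if "a \<in> N" "b \<in> N" for a b
        using that Zc Z.m_closed \<iota>_mult by (fastforce simp: N_def Q.inv_mult)
    qed
    fix x h assume x: "x \<in> carrier ?P" and h: "h \<in> N"
    have hc: "h \<in> carrier ?P"
      using h Zc by (auto simp: N_def)
    have "x \<otimes>\<^bsub>?P\<^esub> h = h \<otimes>\<^bsub>?P\<^esub> x"
      using x h Zc by (auto simp: N_def Q.m_comm)
    then have "x \<otimes>\<^bsub>?P\<^esub> h \<otimes>\<^bsub>?P\<^esub> inv\<^bsub>?P\<^esub> x = h"
      using x hc by (metis P.inv_solve_right' P.m_closed)
    with h show "x \<otimes>\<^bsub>?P\<^esub> h \<otimes>\<^bsub>?P\<^esub> inv\<^bsub>?P\<^esub> x \<in> N"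
      by simp
  qed
  then interpret N: normal N ?P .
  let ?\<phi> = "\<lambda>y. ?Z #>\<^bsub>G\<^esub> fst y"
  have "(\<lambda>a. ?Z #>\<^bsub>G\<^esub> a) \<in> hom G (G Mod ?Z)"
    by (rule Z.r_coset_hom_Mod)
  then have \<phi>: "?\<phi> \<in> hom ?P (G Mod ?Z)"
    by (auto simp: hom_def mult_DirProd')
  have "\<exists>\<eta>. \<eta> \<in> hom (?P Mod N) (G Mod ?Z) \<and> (\<forall>y\<in>carrier ?P. \<eta> (\<theta> y) = ?\<phi> y)"
  proof (rule FactGroup_universal[OF \<phi> \<open>N \<lhd> ?P\<close>])
    fix x y assume xy: "x \<in> carrier ?P" "y \<in> carrier ?P" "N #>\<^bsub>?P\<^esub> x = N #>\<^bsub>?P\<^esub> y"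
    then have "x \<in> N #>\<^bsub>?P\<^esub> y"
      using P.rcos_self[OF _ N.subgroup_axioms] by blast
    then have "fst x \<in> ?Z #>\<^bsub>G\<^esub> fst y"
      by (auto simp: r_coset_def N_def mult_DirProd')
    then show "?\<phi> x = ?\<phi> y"
      using G.repr_independence[OF _ _ Z.subgroup_axioms, of "fst x" "fst y"] xy by auto
  qed (auto simp: \<theta>_def)
  then obtain \<eta> where \<eta>: "\<eta> \<in> hom (?P Mod N) (G Mod ?Z)"
    "\<And>y. y \<in> carrier ?P \<Longrightarrow> \<eta> (\<theta> y) = ?\<phi> y"
    by blast
  have carE: "carrier (?P Mod N) = \<theta> ` carrier ?P"
    by (simp add: carrier_FactGroup \<theta>_def)
  have mon: "(\<lambda>x. \<theta> (\<one>\<^bsub>G\<^esub>, x)) \<in> mon Q (?P Mod N)"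
    unfolding mon_def
  proof (intro CollectI conjI)
    have "(\<lambda>x. (\<one>\<^bsub>G\<^esub>, x)) \<in> hom Q ?P"
      by (auto simp: hom_def)
    from Group.hom_compose[OF this N.r_coset_hom_Mod]
    show "(\<lambda>x. \<theta> (\<one>\<^bsub>G\<^esub>, x)) \<in> hom Q (?P Mod N)"
      by (simp add: \<theta>_def o_def)
    show "inj_on (\<lambda>x. \<theta> (\<one>\<^bsub>G\<^esub>, x)) (carrier Q)"
    proof (rule inj_onI)
      fix x y assume xy: "x \<in> carrier Q" "y \<in> carrier Q" "\<theta> (\<one>\<^bsub>G\<^esub>, x) = \<theta> (\<one>\<^bsub>G\<^esub>, y)"
      then have "(\<one>\<^bsub>G\<^esub>, x) \<in> N #>\<^bsub>?P\<^esub> (\<one>\<^bsub>G\<^esub>, y)"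
        using P.rcos_self[OF _ N.subgroup_axioms, of "(\<one>\<^bsub>G\<^esub>, x)"] by (simp add: \<theta>_def)
      then obtain z where z: "z \<in> ?Z" "\<one>\<^bsub>G\<^esub> = z \<otimes>\<^bsub>G\<^esub> \<one>\<^bsub>G\<^esub>" "x = inv\<^bsub>Q\<^esub> (\<iota> z) \<otimes>\<^bsub>Q\<^esub> y"
        by (auto simp: r_coset_def N_def)
      then have "z = \<one>\<^bsub>G\<^esub>"
        using Zc by simp
      with z xy show "x = y"
        by (simp add: \<iota>_one)
    qed
  qed
  have "kernel (?P Mod N) (G Mod ?Z) \<eta> = (\<lambda>x. \<theta> (\<one>\<^bsub>G\<^esub>, x)) ` carrier Q"
  proof (intro equalityI subsetI)
    fix X assume "X \<in> kernel (?P Mod N) (G Mod ?Z) \<eta>"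
    then obtain g x where X: "X = \<theta> (g, x)" "g \<in> carrier G" "x \<in> carrier Q" "?Z #>\<^bsub>G\<^esub> g = ?Z"
      using \<eta>(2) by (auto simp: kernel_def carE)
    then have g: "g \<in> ?Z"
      using G.coset_join1 Z.subgroup_axioms by blast
    \<comment> \<open>The pair (g, x) is the product of (g, \<iota>(g)^-1), an element of
      \<open>N\<close>, with (1, \<iota>(g) x).\<close>
    let ?x = "\<iota> g \<otimes>\<^bsub>Q\<^esub> x"
    have "(g, x) \<in> N #>\<^bsub>?P\<^esub> (\<one>\<^bsub>G\<^esub>, ?x)"
      using g Zc X by (auto simp: r_coset_def N_def Q.m_assoc[symmetric] intro!: exI[of _ g])
    then have "X = \<theta> (\<one>\<^bsub>G\<^esub>, ?x)"
      unfolding X \<theta>_def using P.repr_independence[OF _ _ N.subgroup_axioms] Zc[OF g] X by simp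
    then show "X \<in> (\<lambda>x. \<theta> (\<one>\<^bsub>G\<^esub>, x)) ` carrier Q"
      using Zc[OF g] X by auto
  next
    fix X assume "X \<in> (\<lambda>x. \<theta> (\<one>\<^bsub>G\<^esub>, x)) ` carrier Q"
    then show "X \<in> kernel (?P Mod N) (G Mod ?Z) \<eta>"
      using \<eta>(2) G.coset_join2[OF _ Z.subgroup_axioms Z.one_closed]
      by (auto simp: kernel_def carE)
  qed
  moreover have "\<eta> \<in> epi (?P Mod N) (G Mod ?Z)"
    unfolding epi_def
  proof (intro CollectI conjI \<eta>(1))
    have "\<eta> ` carrier (?P Mod N) = ?\<phi> ` carrier ?P"
      using \<eta>(2) by (auto simp: carE image_image)
    also have "\<dots> = carrier (G Mod ?Z)"
      using Q.one_closed by (force simp: carrier_FactGroup)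
    finally show "\<eta> ` carrier (?P Mod N) = carrier (G Mod ?Z)" .
  qed
  ultimately have "short_exact Q (?P Mod N) (G Mod ?Z) (\<lambda>x. \<theta> (\<one>\<^bsub>G\<^esub>, x)) \<eta>"
    using mon Q.group_axioms N.factorgroup_is_group Z.factorgroup_is_group
    by (simp add: short_exact_def)
  then show ?thesis
    using \<eta>(2) by (intro that[of \<eta>]) auto
qed

section \<open>The center of the cover and its quotient\<close>

context symplectic_cover
begin

text \<open>Surjectivity of \<open>p\<close> carries central elements to central ones. Conversely,
  if \<open>p z\<close> is 1 or -1, left and right multiplication of a path from the identity by
  \<open>z\<close> lift the same path and both start at \<open>z\<close>.\<close>

lemma center_eq: "center G = {z \<in> carrier G. p z \<in> {mat 1, - mat 1}}"
proof (intro equalityI subsetI)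
  fix z assume z: "z \<in> center G"
  have "p z ** M = M ** p z" if M: "M \<in> carrier Sp" for M
  proof -
    obtain g where "g \<in> carrier G" "M = p g"
      using M p_surj by (metis imageE)
    with z have "z \<in> carrier G" "z \<otimes> g = g \<otimes> z"
      by (auto simp: center_def)
    then show ?thesis
      unfolding \<open>M = p g\<close> using p_mult[of z g] p_mult[of g z] \<open>g \<in> carrier G\<close> by simp
  qed
  then show "z \<in> {z \<in> carrier G. p z \<in> {mat 1, - mat 1}}"
    using z Sp_central_imp_scalar[of "p z"] p_in_Sp[of z] by (auto simp: center_def)
next
  fix z assume z: "z \<in> {z \<in> carrier G. p z \<in> {mat 1, - mat 1}}"
  have "z \<otimes> g = g \<otimes> z" if g: "g \<in> carrier G" for g
  proof -
    obtain c where c: "continuous_on {0..1::real} c" "c ` {0..1} \<subseteq> carrier G" "c 0 = \<one>" "c 1 = g"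
      using path_from_one g by metis
    have "z \<otimes> c 1 = c 1 \<otimes> z"
    proof (rule unique_lift[of "{0..1::real}" "\<lambda>s. z \<otimes> c s" "\<lambda>s. c s \<otimes> z" 0])
      show "continuous_on {0..1} (\<lambda>s. z \<otimes> c s)" "continuous_on {0..1} (\<lambda>s. c s \<otimes> z)"
        using c z by (auto intro!: continuous_on_G_mult)
      show "p (z \<otimes> c s) = p (c s \<otimes> z)" if "s \<in> {0..1}" for s
      proof -
        have "c s \<in> carrier G" using c(2) that by auto
        with z show ?thesis
          by (auto simp: mat_mult_minus_left mat_mult_minus_right)
      qed
    qed (use c z in auto)
    then show ?thesis by (simp add: c)
  qed
  then show "z \<in> center G"
    using z by (simp add: center_def)
qed

lemma minus_one_normal: "{mat 1, - mat 1} \<lhd> (Sp :: (real^('n + 'n)^('n + 'n)) monoid)"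
proof (rule K.normal_invI)
  have inv: "inv\<^bsub>Sp\<^esub> (- mat 1) = (- mat 1 :: real^('n + 'n)^('n + 'n))"
    by (rule K.inv_equality) (simp_all add: uminus_Sp_closed Sp_one_closed mat_algebra)
  show "subgroup {mat 1, - mat 1} (Sp :: (real^('n + 'n)^('n + 'n)) monoid)"
    using inv K.inv_one
    by (intro K.subgroupI) (auto simp: uminus_Sp_closed Sp_one_closed mat_algebra)
  fix x h :: "real^('n + 'n)^('n + 'n)" assume "x \<in> carrier Sp" "h \<in> {mat 1, - mat 1}"
  then show "x \<otimes>\<^bsub>Sp\<^esub> h \<otimes>\<^bsub>Sp\<^esub> inv\<^bsub>Sp\<^esub> x \<in> {mat 1, - mat 1}"
    using K.r_inv[of x] by (auto simp: mat_algebra)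
qed

text \<open>The first isomorphism theorem for the map from \<open>G\<close> to PSp, whose kernel is
  the preimage of 1 and -1.\<close>

lemma center_quotient_iso:
  obtains \<kappa> where "\<kappa> \<in> iso (G Mod center G) (PSp :: (real^('n + 'n)^('n + 'n)) set monoid)"
    "\<And>g. g \<in> carrier G \<Longrightarrow> \<kappa> (center G #> g) = {mat 1, - mat 1} #>\<^bsub>Sp\<^esub> p g"
proof -
  let ?E = "{mat 1, - mat 1} :: (real^('n + 'n)^('n + 'n)) set"
  interpret E: normal ?E Sp by (rule minus_one_normal)
  let ?h = "\<lambda>g. ?E #>\<^bsub>Sp\<^esub> p g"
  have "?h \<in> hom G PSp"
    using Group.hom_compose[OF p_hom E.r_coset_hom_Mod] by (simp add: o_def PSp_def)
  then interpret h: group_hom G PSp ?h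
    using E.factorgroup_is_group G.group_axioms
    by (simp add: group_hom_def group_hom_axioms_def PSp_def)
  have surj: "?h ` carrier G = carrier PSp"
    by (simp add: PSp_def carrier_FactGroup flip: p_surj) (simp add: image_image)
  have "?h g = ?E \<longleftrightarrow> p g \<in> ?E" if "g \<in> carrier G" for g
    using K.coset_join1[OF _ p_in_Sp[OF that] E.subgroup_axioms]
      K.coset_join2[OF p_in_Sp[OF that] E.subgroup_axioms] by blast
  then have ker: "kernel G PSp ?h = center G"
    unfolding center_eq kernel_def PSp_def one_FactGroup by blast
  show ?thesis
  proof (rule that)
    show "(\<lambda>X. the_elem (?h ` X)) \<in> iso (G Mod center G) PSp"
      using h.FactGroup_iso_set[OF surj] by (simp add: ker)
    fix g assume g: "g \<in> carrier G"
    have "?h x = ?h g" if x: "x \<in> center G #> g" for x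
    proof -
      obtain z where z: "z \<in> center G" "x = z \<otimes> g"
        using x by (auto simp: r_coset_def)
      have "?h z = \<one>\<^bsub>PSp\<^esub>"
        using z(1) by (simp add: kernel_def flip: ker)
      then show ?thesis
        using z g h.hom_mult[of z g] h.H.l_one[OF h.hom_closed[OF g]] by (simp add: center_def)
    qed
    moreover have "g \<in> center G #> g"
      using g center_normal[OF G.group_axioms] by (simp add: G.rcos_self normal_imp_subgroup)
    ultimately have "?h ` (center G #> g) = {?h g}"
      by blast
    then show "the_elem (?h ` (center G #> g)) = ?h g"
      by simp
  qed
qed

end

section \<open>The subgroups H and R and the quotient HR/H\<close>

context symplectic_cover_rotation
begin

lemma center_unitary: "center G \<subseteq> unitary_cover"
  by (auto simp: center_eq unitary_cover_def mat_1_unitary uminus_mat_1_unitary)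

lemma det_\<alpha>: "k \<in> unitary_cover \<Longrightarrow> symplectic_det (p k) = exp (\<i> * complex_of_real (real CARD('n) * \<alpha> k))"
  by (rule angle_det[OF angle_\<alpha>])

lemma subgroup_H_eq: "subgroup_H G p = {k \<in> unitary_cover. \<alpha> k = 0}"
proof -
  define S where "S = {k \<in> unitary_cover. symplectic_det (p k) = 1}"
  have H: "subgroup_H G p = connected_component_set S \<one>"
    unfolding subgroup_H_def special_unitary_image
    by (rule arg_cong2[where f = connected_component_set]) (auto simp: S_def unitary_cover_def)
  show ?thesis
  proof (intro equalityI subsetI)
    fix k assume "k \<in> subgroup_H G p"
    then obtain T where T: "connected T" "T \<subseteq> S" "\<one> \<in> T" "k \<in> T"
      by (auto simp: H connected_component_def)
    \<comment> \<open>A connected subset of the reals that is countable has at most one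
      point.\<close>
    have "\<alpha> x \<in> range (\<lambda>m :: int. 2 * pi * of_int m / real CARD('n))" if "x \<in> T" for x
    proof -
      have "exp (\<i> * complex_of_real (real CARD('n) * \<alpha> x)) = 1"
        using det_\<alpha>[of x] that T(2) by (auto simp: S_def)
      then obtain m :: int where "real CARD('n) * \<alpha> x = of_int (2 * m) * pi"
        by (auto simp: exp_eq_1)
      then have "\<alpha> x = 2 * pi * of_int m / real CARD('n)"
        by (simp add: field_simps)
      then show ?thesis by blast
    qed
    then have "\<alpha> ` T \<subseteq> range (\<lambda>m :: int. 2 * pi * of_int m / real CARD('n))"
      by (rule image_subsetI)
    then have "countable (\<alpha> ` T)"
      by (rule countable_subset) (intro countable_image countableI_type)
    moreover have "connected (\<alpha> ` T)"
      using T by (intro connected_continuous_image continuous_on_subset[OF continuous_on_\<alpha>])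
        (auto simp: S_def)
    ultimately have "\<alpha> k = \<alpha> \<one>"
      using connected_uncountable T(3,4) by blast
    then show "k \<in> {k \<in> unitary_cover. \<alpha> k = 0}"
      using T by (auto simp: S_def)
  next
    fix k assume "k \<in> {k \<in> unitary_cover. \<alpha> k = 0}"
    then have "angle k 0"
      using angle_\<alpha>[of k] by simp
    then obtain c b where c: "continuous_on {0..1::real} c" "c ` {0..1} \<subseteq> unitary_cover" "c 0 = \<one>" "c 1 = k"
      "continuous_on {0..1} b" "b 0 = 0" "b 1 = 0"
      "\<And>s. s \<in> {0..1} \<Longrightarrow> symplectic_det (p (c s)) = exp (\<i> * complex_of_real (real CARD('n) * b s))"
      unfolding angle_def by metis
    have cu: "c s \<in> unitary_cover" if "s \<in> {0..1}" for s
      using c(2) that by auto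
    \<comment> \<open>Dividing by the rotation of angle \<open>b s\<close> makes the determinant 1
      along the whole path; \<open>b\<close> vanishes at both ends, so the endpoints are
      unchanged.\<close>
    let ?d = "\<lambda>s. c s \<otimes> \<sigma> (- b s)"
    have "continuous_on {0..1} ?d"
      using c cu unitary_cover_carrier
      by (intro continuous_on_G_mult continuous_on_\<sigma> continuous_intros) auto
    then have "connected (?d ` {0..1})"
      by (intro connected_continuous_image) auto
    moreover have "?d ` {0..1} \<subseteq> S"
    proof (rule image_subsetI)
      fix s :: real assume s: "s \<in> {0..1}"
      have "?d s \<in> unitary_cover"
        using subgroup.m_closed[OF unitary_cover_subgroup cu[OF s]] by simp
      moreover have "symplectic_det (p (?d s)) = 1"
        using cu[OF s] c(8)[OF s]
        by (simp add: unitary_cover_def symplectic_det_mult p_\<sigma> rotation_unitary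
            symplectic_det_rotation flip: exp_add)
      ultimately show "?d s \<in> S"
        by (simp add: S_def)
    qed
    moreover have "\<one> = ?d 0"
      using c by simp
    then have "\<one> \<in> ?d ` {0..1}"
      by (rule image_eqI) simp
    moreover have "k = ?d 1"
      using c cu[of 1] unitary_cover_carrier by simp
    then have "k \<in> ?d ` {0..1}"
      by (rule image_eqI) simp
    ultimately show "k \<in> subgroup_H G p"
      unfolding H connected_component_def by blast
  qed
qed

lemma subgroup_R_eq: "subgroup_R G p = range \<sigma>"
proof -
  define S where "S = {g \<in> carrier G. p g \<in> range rotation}"
  have R: "subgroup_R G p = connected_component_set S \<one>"
    unfolding subgroup_R_def scalar_unitary_image S_def ..
  show ?thesis
  proof (intro equalityI subsetI)
    fix g assume "g \<in> subgroup_R G p"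
    then obtain T where T: "connected T" "T \<subseteq> S" "\<one> \<in> T" "g \<in> T"
      by (auto simp: R connected_component_def)
    have Tu: "T \<subseteq> unitary_cover"
    proof
      fix x assume "x \<in> T"
      then obtain r where "x \<in> carrier G" "p x = rotation r"
        using T(2) by (auto simp: S_def)
      then show "x \<in> unitary_cover"
        by (simp add: unitary_cover_def rotation_unitary)
    qed
    \<comment> \<open>Removing the angle of \<open>x\<close> leaves an element over a scalar matrix
      of determinant 1, that is over an n-th root of unity. These are finitely many, so the
      projection to Sp is constant on \<open>T\<close>.\<close>
    let ?d = "\<lambda>x. x \<otimes> \<sigma> (- \<alpha> x)"
    let ?Z = "(\<lambda>z. unitary_embedding (mat z) :: real^('n + 'n)^('n + 'n)) ` {z. z ^ CARD('n) = 1}"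
    have d: "?d x \<in> carrier G" "p (?d x) \<in> ?Z" if x: "x \<in> T" for x
    proof -
      show "?d x \<in> carrier G"
        using x Tu unitary_cover_carrier by auto
      have xu: "x \<in> unitary_cover"
        using x Tu by blast
      obtain r where r: "p x = rotation r"
        using x T(2) by (auto simp: S_def)
      have eq: "p (?d x) = rotation (r - \<alpha> x)"
        using xu by (simp add: unitary_cover_carrier r p_\<sigma> flip: rotation_add)
      have "exp (\<i> * complex_of_real (real CARD('n) * r)) = exp (\<i> * complex_of_real (real CARD('n) * \<alpha> x))"
        using det_\<alpha>[OF xu] by (simp add: r symplectic_det_rotation)
      then have "exp (\<i> * complex_of_real (real CARD('n) * (r - \<alpha> x))) = 1"
        by (simp add: right_diff_distrib exp_diff)
      then have "exp (\<i> * complex_of_real (r - \<alpha> x)) ^ CARD('n) = 1"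
        by (simp add: exp_of_nat_mult[symmetric] mult.left_commute)
      then show "p (?d x) \<in> ?Z"
        unfolding eq rotation_def by blast
    qed
    have cd: "continuous_on T ?d"
      using Tu unitary_cover_carrier
      by (intro continuous_on_G_mult continuous_on_\<sigma> continuous_intros
          continuous_on_subset[OF continuous_on_\<alpha>]) auto
    have "connected ((\<lambda>x. p (?d x)) ` T)"
      using T(1) cd d(1) by (intro connected_continuous_image continuous_on_p) auto
    moreover have "(\<lambda>x. p (?d x)) ` T \<subseteq> ?Z"
      using d(2) by (rule image_subsetI)
    moreover have "finite ?Z"
      by (intro finite_imageI finite_roots_unity) simp
    ultimately have "connected ((\<lambda>x. p (?d x)) ` T)" "countable ((\<lambda>x. p (?d x)) ` T)"
      using countable_finite finite_subset by blast+
    then have "p (?d x) = p (?d \<one>)" if "x \<in> T" for x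
      using connected_uncountable that T(3) by blast
    \<comment> \<open>The constant is the identity, so \<open>?d\<close> takes values in the kernel
      of \<open>p\<close> and is itself constant.\<close>
    then have "p (?d x) = \<one>\<^bsub>Sp\<^esub>" if "x \<in> T" for x
      using that by simp
    then have "?d g = ?d \<one>"
      by (intro kernel_valued_constant[OF T(1) cd]) (use d(1) T in auto)
    then have "g \<otimes> inv (\<sigma> (\<alpha> g)) = \<one>"
      by (simp add: inv_\<sigma>)
    then have "g = \<sigma> (\<alpha> g)"
      using T(4) Tu unitary_cover_carrier by (metis G.inv_equality G.inv_inv G.inv_closed \<sigma>_closed subsetD)
    then show "g \<in> range \<sigma>" by blast
  next
    fix g assume "g \<in> range \<sigma>"
    moreover have "connected (range \<sigma>)"
      by (intro connected_continuous_image \<sigma>_continuous) auto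
    moreover have "range \<sigma> \<subseteq> S"
      by (auto simp: S_def p_\<sigma>)
    moreover have "\<one> \<in> range \<sigma>"
      using \<sigma>_0 by (metis rangeI)
    ultimately show "g \<in> subgroup_R G p"
      unfolding R connected_component_def by blast
  qed
qed

lemma unitary_cover_decomp:
  assumes "k \<in> unitary_cover"
  obtains h where "h \<in> subgroup_H G p" "k = h \<otimes> \<sigma> (\<alpha> k)"
proof
  have "k \<otimes> \<sigma> (- \<alpha> k) \<in> unitary_cover"
    using assms subgroup.m_closed[OF unitary_cover_subgroup] by simp
  then show "k \<otimes> \<sigma> (- \<alpha> k) \<in> subgroup_H G p"
    using assms by (simp add: subgroup_H_eq \<alpha>_mult)
  show "k = k \<otimes> \<sigma> (- \<alpha> k) \<otimes> \<sigma> (\<alpha> k)"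
    using unitary_cover_carrier[OF assms] by (simp add: G.m_assoc flip: \<sigma>_add)
qed

lemma group_HR_eq: "group_HR G p = G\<lparr>carrier := unitary_cover\<rparr>"
proof -
  have "subgroup_H G p <#> subgroup_R G p = unitary_cover"
  proof (intro equalityI subsetI)
    fix k assume "k \<in> subgroup_H G p <#> subgroup_R G p"
    then show "k \<in> unitary_cover"
      using subgroup.m_closed[OF unitary_cover_subgroup]
      by (auto simp: set_mult_def subgroup_H_eq subgroup_R_eq)
  next
    fix k assume "k \<in> unitary_cover"
    then obtain h where "h \<in> subgroup_H G p" "k = h \<otimes> \<sigma> (\<alpha> k)"
      by (rule unitary_cover_decomp)
    then show "k \<in> subgroup_H G p <#> subgroup_R G p"
      unfolding set_mult_def subgroup_R_eq by blast
  qed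
  then show ?thesis
    by (simp add: group_HR_def)
qed

lemma group_HR_group: "Group.group (group_HR G p)"
  unfolding group_HR_eq by (rule G.subgroup_imp_group[OF unitary_cover_subgroup])

text \<open>It is the kernel of the homomorphism \<open>\<alpha>\<close> to the reals.\<close>

lemma subgroup_H_normal: "subgroup_H G p \<lhd> group_HR G p"
proof -
  have "\<alpha> \<in> hom (group_HR G p) real_group"
    by (auto simp: hom_def group_HR_eq \<alpha>_mult)
  then interpret a: group_hom "group_HR G p" real_group \<alpha>
    by (simp add: group_hom_def group_hom_axioms_def group_HR_group real_group_group)
  have "kernel (group_HR G p) real_group \<alpha> = subgroup_H G p"
    by (auto simp: kernel_def group_HR_eq subgroup_H_eq)
  then show ?thesis
    using a.normal_kernel by simp
qed

lemma quot_H_hom: "quot_H G p \<in> hom (group_HR G p) (HR_mod_H G p)"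
  using normal.r_coset_hom_Mod[OF subgroup_H_normal]
  by (simp add: quot_H_def[abs_def] HR_mod_H_def)

text \<open>Elements of H have angle 0, so \<open>\<alpha>\<close> separates the cosets of different
  \<open>\<sigma> t\<close>; and every \<open>k\<close> over U(n) differs from
  \<open>\<sigma> (\<alpha> k)\<close> by an element of H.\<close>

lemma quot_H_iso: "(\<lambda>t. quot_H G p (\<sigma> t)) \<in> iso real_group (HR_mod_H G p)"
proof (rule isoI)
  have "\<sigma> \<in> hom real_group (group_HR G p)"
    by (auto simp: hom_def group_HR_eq \<sigma>_add)
  from Group.hom_compose[OF this quot_H_hom]
  show "(\<lambda>t. quot_H G p (\<sigma> t)) \<in> hom real_group (HR_mod_H G p)"
    by (simp add: o_def)
  interpret K: group "group_HR G p" by (rule group_HR_group)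
  note sub = normal_imp_subgroup[OF subgroup_H_normal]
  have mult: "x \<otimes>\<^bsub>group_HR G p\<^esub> y = x \<otimes> y" for x y
    by (simp add: group_HR_eq)
  have car: "carrier (group_HR G p) = unitary_cover"
    by (simp add: group_HR_eq)
  have "inj (\<lambda>t. quot_H G p (\<sigma> t))"
  proof (rule injI)
    fix s t assume "quot_H G p (\<sigma> s) = quot_H G p (\<sigma> t)"
    then have "\<sigma> s \<in> subgroup_H G p #>\<^bsub>group_HR G p\<^esub> \<sigma> t"
      using K.rcos_self[OF _ sub, of "\<sigma> s"] by (simp add: quot_H_def car)
    then obtain h where "h \<in> subgroup_H G p" "\<sigma> s = h \<otimes> \<sigma> t"
      by (auto simp: r_coset_def mult)
    then show "s = t"
      using \<alpha>_mult[of h "\<sigma> t"] by (simp add: subgroup_H_eq) (metis \<alpha>_\<sigma>)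
  qed
  moreover have quot_eq: "quot_H G p k = quot_H G p (\<sigma> (\<alpha> k))" if k: "k \<in> unitary_cover" for k
  proof -
    obtain h where "h \<in> subgroup_H G p" "k = h \<otimes> \<sigma> (\<alpha> k)"
      using unitary_cover_decomp k by metis
    then have "k \<in> subgroup_H G p #>\<^bsub>group_HR G p\<^esub> \<sigma> (\<alpha> k)"
      by (auto simp: r_coset_def mult)
    then show ?thesis
      unfolding quot_H_def using K.repr_independence[OF _ _ sub] by (simp add: car)
  qed
  have "quot_H G p ` unitary_cover = range (\<lambda>t. quot_H G p (\<sigma> t))"
  proof (intro equalityI image_subsetI)
    fix k assume "k \<in> unitary_cover"
    from quot_eq[OF this] show "quot_H G p k \<in> range (\<lambda>t. quot_H G p (\<sigma> t))"
      by (rule image_eqI) simp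
  qed simp
  then have "range (\<lambda>t. quot_H G p (\<sigma> t)) = carrier (HR_mod_H G p)"
    by (simp add: HR_mod_H_def carrier_FactGroup car quot_H_def[abs_def])
  ultimately show "bij_betw (\<lambda>t. quot_H G p (\<sigma> t)) (carrier real_group) (carrier (HR_mod_H G p))"
    by (simp add: bij_betw_def)
qed

text \<open>Commutativity is transported from the reals along \<open>quot_H_iso\<close>.\<close>

lemma HR_mod_H_comm_group: "comm_group (HR_mod_H G p)"
proof -
  have "Group.group (HR_mod_H G p)"
    unfolding HR_mod_H_def by (rule normal.factorgroup_is_group[OF subgroup_H_normal])
  moreover have "x \<otimes>\<^bsub>HR_mod_H G p\<^esub> y = y \<otimes>\<^bsub>HR_mod_H G p\<^esub> x"
    if xy: "x \<in> carrier (HR_mod_H G p)" "y \<in> carrier (HR_mod_H G p)" for x y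
  proof -
    let ?f = "\<lambda>t. quot_H G p (\<sigma> t)"
    have f: "?f (s + t) = ?f s \<otimes>\<^bsub>HR_mod_H G p\<^esub> ?f t" for s t
      using quot_H_iso hom_mult[of ?f real_group "HR_mod_H G p" s t] by (simp add: iso_def)
    have "range ?f = carrier (HR_mod_H G p)"
      using quot_H_iso by (simp add: iso_def bij_betw_def)
    then obtain s t where "x = ?f s" "y = ?f t"
      using xy by (metis imageE)
    then show ?thesis
      by (metis f add.commute)
  qed
  ultimately show ?thesis
    by (intro group.group_comm_groupI)
qed

lemma \<sigma>_iso: "\<sigma> \<in> iso real_group (G\<lparr>carrier := subgroup_R G p\<rparr>)"
proof (rule isoI)
  show "\<sigma> \<in> hom real_group (G\<lparr>carrier := subgroup_R G p\<rparr>)"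
    by (auto simp: hom_def subgroup_R_eq \<sigma>_add)
  have "inj \<sigma>"
    by (rule inj_on_inverseI[of _ \<alpha>]) simp
  then show "bij_betw \<sigma> (carrier real_group) (carrier (G\<lparr>carrier := subgroup_R G p\<rparr>))"
    by (simp add: bij_betw_def subgroup_R_eq)
qed

lemma \<sigma>_homeomorphism: "homeomorphism UNIV (subgroup_R G p) \<sigma> \<alpha>"
  unfolding homeomorphism_def subgroup_R_eq
  by (auto intro: \<sigma>_continuous continuous_on_subset[OF continuous_on_\<alpha>] simp: image_image)

text \<open>The central product construction with \<open>quot_H\<close> restricted to the center,
  which is legitimate because the center lies over U(n).\<close>

lemma extension_exact:
  obtains \<eta> where "short_exact (HR_mod_H G p) (extension_E G p) (G Mod center G)
      (\<lambda>x. theta G p (\<one>, x)) \<eta>"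
    "\<And>g x. g \<in> carrier G \<Longrightarrow> x \<in> carrier (HR_mod_H G p) \<Longrightarrow> \<eta> (theta G p (g, x)) = center G #> g"
proof -
  have "quot_H G p \<in> hom (G\<lparr>carrier := center G\<rparr>) (HR_mod_H G p)"
    using quot_H_hom center_unitary
    by (simp add: hom_def group_HR_eq Pi_iff subset_iff)
  from central_product_exact[OF G.group_axioms HR_mod_H_comm_group this,
      folded antidiagonal_center_def, folded theta_def extension_E_def]
  show ?thesis
    using that by blast
qed

end

theorem proposition1p3:
  fixes G :: "('g::topological_space, 'm) monoid_scheme"
    and p :: "'g \<Rightarrow> real^('n::finite + 'n)^('n + 'n)"
  assumes "CARD('n) \<ge> 2"
    and "universal_covering_group G p Sp"
  shows "\<exists>\<sigma> \<tau> \<eta> \<kappa>.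
    \<sigma> \<in> iso real_group (G\<lparr>carrier := subgroup_R G p\<rparr>) \<and>
    homeomorphism UNIV (subgroup_R G p) \<sigma> \<tau> \<and>
    (\<lambda>t. quot_H G p (\<sigma> t)) \<in> iso real_group (HR_mod_H G p) \<and>
    short_exact (HR_mod_H G p) (extension_E G p) (G Mod center G)
      (\<lambda>x. theta G p (\<one>\<^bsub>G\<^esub>, x)) \<eta> \<and>
    short_exact real_group (extension_E G p) (G Mod center G)
      (\<lambda>t. theta G p (\<one>\<^bsub>G\<^esub>, quot_H G p (\<sigma> t))) \<eta> \<and>
    (\<forall>g \<in> carrier G. \<forall>x \<in> carrier (HR_mod_H G p).
       \<eta> (theta G p (g, x)) = center G #>\<^bsub>G\<^esub> g) \<and>
    \<kappa> \<in> iso (G Mod center G) (PSp :: (real^('n + 'n)^('n + 'n)) set monoid) \<and>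
    (\<forall>g \<in> carrier G.
       \<kappa> (center G #>\<^bsub>G\<^esub> g) = {mat 1, - mat 1} #>\<^bsub>Sp\<^esub> p g)"
proof -
  interpret symplectic_cover G p
    by unfold_locales (rule assms)
  obtain \<sigma> where \<sigma>: "continuous_on UNIV \<sigma>" "range \<sigma> \<subseteq> carrier G" "\<sigma> 0 = \<one>\<^bsub>G\<^esub>"
    "\<And>t. p (\<sigma> t) = rotation t"
    using rotation_lift by metis
  interpret symplectic_cover_rotation G p \<sigma>
    by unfold_locales (use \<sigma> in auto)
  obtain \<eta> where \<eta>: "short_exact (HR_mod_H G p) (extension_E G p) (G Mod center G)
      (\<lambda>x. theta G p (\<one>\<^bsub>G\<^esub>, x)) \<eta>"
    "\<And>g x. g \<in> carrier G \<Longrightarrow> x \<in> carrier (HR_mod_H G p) \<Longrightarrow>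
       \<eta> (theta G p (g, x)) = center G #>\<^bsub>G\<^esub> g"
    using extension_exact by metis
  obtain \<kappa> where \<kappa>: "\<kappa> \<in> iso (G Mod center G) (PSp :: (real^('n + 'n)^('n + 'n)) set monoid)"
    "\<And>g. g \<in> carrier G \<Longrightarrow> \<kappa> (center G #>\<^bsub>G\<^esub> g) = {mat 1, - mat 1} #>\<^bsub>Sp\<^esub> p g"
    using center_quotient_iso by metis
  have "short_exact real_group (extension_E G p) (G Mod center G)
      (\<lambda>t. theta G p (\<one>\<^bsub>G\<^esub>, quot_H G p (\<sigma> t))) \<eta>"
    by (rule short_exact_iso_comp[OF quot_H_iso \<eta>(1) real_group_group])
  then show ?thesis
    using \<sigma>_iso \<sigma>_homeomorphism quot_H_iso \<eta> \<kappa>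
    by (intro exI[of _ \<sigma>] exI[of _ \<alpha>] exI[of _ \<eta>] exI[of _ \<kappa>]) simp
qed

end
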